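(* Let $\mathcal K$ be an unbounded convex domain in $\mathbb R^{n+1}$ which contains no lines. Then, under the affine normal flow, $\mathcal K(t)\neq\emptyset$ for all $t>0$.
   Context: Here $n\ge 1$; a convex domain is a nonempty open convex subset of $\mathbb R^{n+1}$, and "contains no lines" means contains no complete affine straight line. A smooth hypersurface in $\mathbb R^{n+1}$ is called strictly convex if its Euclidean second fundamental form $h_{ij}$ with respect to the inward unit normal $\nu$ is positive definite. Its affine normal is the inward-pointing transverse vector field $\xi=-h^{ki}\,\partial_i\phi\,\partial_kF+\phi\,\nu$, where $F$ is a local parametrization, $h^{ki}$ is the inverse matrix of $h_{ij}$, $\phi=K^{1/(n+2)}$ and $K$ is the Gauss curvature. Flow of smooth compact hypersurfaces: if $\mathcal J\subset\mathbb R^{n+1}$ is a bounded open convex domain with smooth strictly convex boundary, the affine normal flow $\partial_tF=\xi$ started from $\partial\mathcal J$ has a unique smooth strictly convex solution, which exists up to a finite extinction time, at which it has contracted to a point. $\mathcal J(t)$ denotes the open convex domain bounded by the solution at time $t$; from the extinction time on, $\mathcal J(t)=\emptyset$. Flow of general convex sets: for an open convex set $\mathcal K\subset\mathbb R^{n+1}$ and $t\ge 0$, $\mathcal K(t)=\bigcup_{\mathcal J\subset\mathcal K}\mathcal J(t)$, the union being over all bounded open convex domains $\mathcal J\subset\mathcal K$ with smooth strictly convex boundary. *)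

theory Defs
  imports "HOL-Analysis.Analysis"
begin

text \<open>
  Euclidean space of dimension n + 1 is modelled as \<open>(real^'n) \<times> real\<close> with its product inner
  product, where n is the cardinality of \<open>'n\<close>; hence n is an arbitrary positive number, and local
  parametrizations of hypersurfaces are maps out of \<open>real^'n\<close>.
\<close>

type_synonym 'n ambient = "(real^'n) \<times> real"

section \<open>Smooth maps\<close>

text \<open>The intended use is on open subsets of finite-dimensional spaces.\<close>

primrec Ck_on :: "nat \<Rightarrow> 'a::real_normed_vector set \<Rightarrow> ('a \<Rightarrow> 'b::real_normed_vector) \<Rightarrow> bool" where
  "Ck_on 0 U f \<longleftrightarrow> continuous_on U f"
| "Ck_on (Suc k) U f \<longleftrightarrow>
     (\<forall>x\<in>U. f differentiable (at x)) \<and> (\<forall>v. Ck_on k U (\<lambda>x. frechet_derivative f (at x) v))"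

definition smooth_on_open :: "'a::real_normed_vector set \<Rightarrow> ('a \<Rightarrow> 'b::real_normed_vector) \<Rightarrow> bool" where
  "smooth_on_open U f \<longleftrightarrow> (\<forall>k. Ck_on k U f)"

text \<open>On an arbitrary set, such as a hypersurface times a half-open time interval, a map is smooth
  if it has smooth extensions to open neighbourhoods of the points of the set.\<close>

definition smooth_map_on :: "'a::real_normed_vector set \<Rightarrow> ('a \<Rightarrow> 'b::real_normed_vector) \<Rightarrow> bool" where
  "smooth_map_on S f \<longleftrightarrow>
     (\<forall>x\<in>S. \<exists>W g. open W \<and> x \<in> W \<and> smooth_on_open W g \<and> (\<forall>y\<in>W \<inter> S. g y = f y))"

section \<open>Hypersurfaces\<close>

definition local_parametrization ::
    "'n::finite ambient set \<Rightarrow> (real^'n) set \<Rightarrow> (real^'n \<Rightarrow> 'n ambient) \<Rightarrow> bool" where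
  "local_parametrization M U X \<longleftrightarrow>
     open U \<and> smooth_on_open U X \<and>
     (\<forall>u\<in>U. inj (frechet_derivative X (at u))) \<and>
     openin (top_of_set M) (X ` U) \<and> (\<exists>Y. homeomorphism U (X ` U) X Y)"

definition smooth_hypersurface :: "'n::finite ambient set \<Rightarrow> bool" where
  "smooth_hypersurface M \<longleftrightarrow> (\<forall>p\<in>M. \<exists>U X. local_parametrization M U X \<and> p \<in> X ` U)"

definition pderiv_at :: "'n::finite \<Rightarrow> (real^'n \<Rightarrow> 'b::real_normed_vector) \<Rightarrow> real^'n \<Rightarrow> 'b" where
  "pderiv_at i f u = frechet_derivative f (at u) (axis i 1)"

text \<open>In the following, \<open>X\<close> is a local parametrization of the frontier of the open convex domain
  \<open>D\<close>, and \<open>D\<close> serves to fix the inward direction.\<close>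

definition inward_normal ::
    "'n::finite ambient set \<Rightarrow> (real^'n \<Rightarrow> 'n ambient) \<Rightarrow> real^'n \<Rightarrow> 'n ambient" where
  "inward_normal D X u =
     (THE \<nu>. norm \<nu> = 1 \<and> (\<forall>i. pderiv_at i X u \<bullet> \<nu> = 0) \<and>
           (\<forall>\<^sub>F s in at_right 0. X u + s *\<^sub>R \<nu> \<in> D))"

definition first_form :: "(real^'n::finite \<Rightarrow> 'n ambient) \<Rightarrow> real^'n \<Rightarrow> real^'n^'n" where
  "first_form X u = (\<chi> i j. pderiv_at i X u \<bullet> pderiv_at j X u)"

definition second_form ::
    "'n::finite ambient set \<Rightarrow> (real^'n \<Rightarrow> 'n ambient) \<Rightarrow> real^'n \<Rightarrow> real^'n^'n" where
  "second_form D X u = (\<chi> i j. pderiv_at i (pderiv_at j X) u \<bullet> inward_normal D X u)"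

definition gauss_curvature ::
    "'n::finite ambient set \<Rightarrow> (real^'n \<Rightarrow> 'n ambient) \<Rightarrow> real^'n \<Rightarrow> real" where
  "gauss_curvature D X u = det (second_form D X u) / det (first_form X u)"

definition affine_phi ::
    "'n::finite ambient set \<Rightarrow> (real^'n \<Rightarrow> 'n ambient) \<Rightarrow> real^'n \<Rightarrow> real" where
  "affine_phi D X u = gauss_curvature D X u powr (1 / (real CARD('n) + 2))"

definition affine_normal ::
    "'n::finite ambient set \<Rightarrow> (real^'n \<Rightarrow> 'n ambient) \<Rightarrow> real^'n \<Rightarrow> 'n ambient" where
  "affine_normal D X u =
     - (\<Sum>k\<in>UNIV. \<Sum>i\<in>UNIV.
          (matrix_inv (second_form D X u) $ k $ i * pderiv_at i (affine_phi D X) u)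
            *\<^sub>R pderiv_at k X u)
     + affine_phi D X u *\<^sub>R inward_normal D X u"

section \<open>Convex domains\<close>

definition convex_domain :: "'n::finite ambient set \<Rightarrow> bool" where
  "convex_domain D \<longleftrightarrow> D \<noteq> {} \<and> open D \<and> convex D"

definition contains_no_lines :: "'a::real_vector set \<Rightarrow> bool" where
  "contains_no_lines S \<longleftrightarrow> (\<forall>a v. v \<noteq> 0 \<longrightarrow> \<not> range (\<lambda>s::real. a + s *\<^sub>R v) \<subseteq> S)"

definition strictly_convex_boundary :: "'n::finite ambient set \<Rightarrow> bool" where
  "strictly_convex_boundary D \<longleftrightarrow>
     (\<forall>U X. local_parametrization (frontier D) U X \<longrightarrow>
        (\<forall>u\<in>U. \<forall>v. v \<noteq> 0 \<longrightarrow> 0 < v \<bullet> (second_form D X u *v v)))"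

definition smooth_bounded_domain :: "'n::finite ambient set \<Rightarrow> bool" where
  "smooth_bounded_domain J \<longleftrightarrow>
     convex_domain J \<and> bounded J \<and> smooth_hypersurface (frontier J) \<and> strictly_convex_boundary J"

section \<open>The affine normal flow\<close>

text \<open>
  \<open>F\<close> is the solution started from the frontier of \<open>J\<close>, parametrized by that frontier; \<open>D t\<close> is the
  convex domain bounded by the hypersurface at time \<open>t\<close>, and \<open>T\<close> is the extinction time.
\<close>

definition affine_normal_flow ::
    "'n::finite ambient set \<Rightarrow> real \<Rightarrow> ('n ambient \<Rightarrow> real \<Rightarrow> 'n ambient) \<Rightarrow>
      (real \<Rightarrow> 'n ambient set) \<Rightarrow> bool" where
  "affine_normal_flow J T F D \<longleftrightarrow>
     0 < T \<and>
     smooth_map_on (frontier J \<times> {0..<T}) (\<lambda>(p, t). F p t) \<and>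
     (\<forall>p\<in>frontier J. F p 0 = p) \<and>
     (\<forall>t\<in>{0..<T}.
        smooth_bounded_domain (D t) \<and>
        frontier (D t) = (\<lambda>p. F p t) ` frontier J \<and>
        inj_on (\<lambda>p. F p t) (frontier J) \<and>
        (\<forall>U X. local_parametrization (frontier J) U X \<longrightarrow>
           local_parametrization (frontier (D t)) U (\<lambda>u. F (X u) t) \<and>
           (\<forall>u\<in>U. ((\<lambda>s. F (X u) s) has_vector_derivative
                       affine_normal (D t) (\<lambda>u. F (X u) t) u) (at t within {0..<T})))) \<and>
     (\<exists>c. uniform_limit (frontier J) (\<lambda>t p. F p t) (\<lambda>p. c) (at_left T))"

text \<open>The family below has at most one member, since solutions are unique; it is empty from
  the extinction time on.\<close>

definition evolved_smooth_domain :: "'n::finite ambient set \<Rightarrow> real \<Rightarrow> 'n ambient set" where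
  "evolved_smooth_domain J t = \<Union>{D t | T F D. affine_normal_flow J T F D \<and> t \<in> {0..<T}}"

definition evolved_convex_set :: "'n::finite ambient set \<Rightarrow> real \<Rightarrow> 'n ambient set" where
  "evolved_convex_set K t = \<Union>{evolved_smooth_domain J t | J. J \<subseteq> K \<and> smooth_bounded_domain J}"

end

theory Submission
  imports Defs
begin

text \<open>
  It is enough to find, for every time \<open>t\<close>, one smooth bounded domain in \<open>K\<close> whose flow is known
  explicitly and survives beyond \<open>t\<close>. Ellipsoids serve this purpose. The affine normal of an ellipsoid
  points to the center and is a constant multiple of the position vector (\<open>affine_normal_eq\<close>), so that
  ellipsoids shrink homothetically, and the differential equation for the homothety factor can be solved
  (\<open>affine_normal_flow_ellipsoid\<close>). The extinction time grows with the volume of the ellipsoid: for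
  fixed semiaxes \<open>r\<close> in all directions but one it tends to infinity with the remaining semiaxis
  \<open>r / sqrt m\<close>, that is, as \<open>m\<close> tends to zero (\<open>less_extinction_time\<close>).

  An unbounded convex domain contains such ellipsoids of any length with the same \<open>r\<close>: the convex hull
  of a fixed ball and a point of \<open>K\<close> at distance \<open>R\<close> from its center contains a tube of length
  \<open>R / 2\<close> whose radius is half that of the ball
  (\<open>unbounded_convex_contains_elongated_ellipsoids\<close>).

  Ellipsoids of revolution are enough, since only one semiaxis has to be long. Their quadratic form
  differs from the Euclidean one by a form of rank one, so the Gauss curvature
  follows from the determinant of a rank-one update of the identity. Local parametrizations of
  their boundaries arise from stereographic coordinates of the sphere by an affine map.
\<close>

section \<open>Calculus of iterated derivatives\<close>

lemma Ck_on_cong: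
  assumes "open U"
  shows "(\<And>x. x \<in> U \<Longrightarrow> f x = g x) \<Longrightarrow> Ck_on k U f \<Longrightarrow> Ck_on k U g"
proof (induction k arbitrary: f g)
  case 0
  then show ?case
    by (metis Ck_on.simps(1) continuous_on_cong)
next
  case (Suc k)
  have der: "(g has_derivative frechet_derivative f (at x)) (at x)" if "x \<in> U" for x
    using that Suc.prems assms
    by (metis Ck_on.simps(2) frechet_derivative_works has_derivative_transform_within_open)
  have "Ck_on k U (\<lambda>x. frechet_derivative g (at x) v)" for v
  proof (rule Suc.IH)
    show "Ck_on k U (\<lambda>x. frechet_derivative f (at x) v)"
      using Suc.prems by simp
    show "frechet_derivative f (at x) v = frechet_derivative g (at x) v" if "x \<in> U" for x
      using frechet_derivative_at[OF der[OF that]] by simp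
  qed
  then show ?case
    using der by (auto simp: differentiable_def)
qed

text \<open>Any explicit formula for the derivative may be used in place of \<open>frechet_derivative\<close>; this is
  what makes the product and chain rules below inductive.\<close>

lemma Ck_on_SucI:
  assumes "open U" and "\<And>x. x \<in> U \<Longrightarrow> (f has_derivative f' x) (at x)"
    and "\<And>v. Ck_on k U (\<lambda>x. f' x v)"
  shows "Ck_on (Suc k) U f"
proof -
  have "Ck_on k U (\<lambda>x. frechet_derivative f (at x) v)" for v
    by (rule Ck_on_cong[OF assms(1) _ assms(3)[of v]]) (simp flip: frechet_derivative_at[OF assms(2)])
  then show ?thesis
    using assms(2) by (auto simp: differentiable_def)
qed

lemma Ck_on_Suc_has_derivative:
  assumes "Ck_on (Suc k) U f" "x \<in> U"
  shows "(f has_derivative frechet_derivative f (at x)) (at x)"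
  using assms frechet_derivative_works by auto

lemma Ck_on_Suc_imp_Ck_on: "Ck_on (Suc k) U f \<Longrightarrow> Ck_on k U f"
proof (induction k arbitrary: f)
  case 0
  then show ?case
    by (auto intro!: differentiable_imp_continuous_on
        simp: differentiable_on_def differentiable_at_withinI)
next
  case (Suc k)
  then show ?case
    by (metis Ck_on.simps(2))
qed

lemma Ck_on_const: "Ck_on k U (\<lambda>x. a)"
  by (induction k arbitrary: a) (auto simp: frechet_derivative_const)

lemma Ck_on_bounded_linear:
  assumes "open U" "bounded_linear L"
  shows "Ck_on k U L"
proof (cases k)
  case 0
  then show ?thesis
    using assms by (simp add: linear_continuous_on)
next
  case (Suc j)
  then show ?thesis
    using Ck_on_SucI[OF assms(1) bounded_linear_imp_has_derivative[OF assms(2)] Ck_on_const]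
    by simp
qed

lemma Ck_on_compose_bounded_linear:
  assumes "open U" "bounded_linear L"
  shows "Ck_on k U f \<Longrightarrow> Ck_on k U (\<lambda>x. L (f x))"
proof (induction k arbitrary: f)
  case 0
  then show ?case
    using bounded_linear.continuous_on[OF assms(2)] by auto
next
  case (Suc k)
  show ?case
  proof (rule Ck_on_SucI[OF assms(1)])
    show "((\<lambda>x. L (f x)) has_derivative (\<lambda>v. L (frechet_derivative f (at x) v))) (at x)"
      if "x \<in> U" for x
      using bounded_linear.has_derivative[OF assms(2) Ck_on_Suc_has_derivative[OF Suc.prems that]] .
  qed (use Suc in auto)
qed

lemma Ck_on_add:
  assumes "open U"
  shows "Ck_on k U f \<Longrightarrow> Ck_on k U g \<Longrightarrow> Ck_on k U (\<lambda>x. f x + g x)"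
proof (induction k arbitrary: f g)
  case 0
  then show ?case
    by (auto intro: continuous_on_add)
next
  case (Suc k)
  show ?case
  proof (rule Ck_on_SucI[OF assms(1)])
    show "((\<lambda>x. f x + g x) has_derivative
        (\<lambda>v. frechet_derivative f (at x) v + frechet_derivative g (at x) v)) (at x)"
      if "x \<in> U" for x
      using Ck_on_Suc_has_derivative[OF Suc.prems(1) that]
        Ck_on_Suc_has_derivative[OF Suc.prems(2) that] by (rule has_derivative_add)
  qed (use Suc in auto)
qed

lemma Ck_on_bilinear:
  assumes "open U" "bounded_bilinear h"
  shows "Ck_on k U f \<Longrightarrow> Ck_on k U g \<Longrightarrow> Ck_on k U (\<lambda>x. h (f x) (g x))"
proof (induction k arbitrary: f g)
  case 0
  then show ?case
    using bounded_bilinear.continuous_on[OF assms(2)] by auto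
next
  case (Suc k)
  show ?case
  proof (rule Ck_on_SucI[OF assms(1)])
    show "((\<lambda>x. h (f x) (g x)) has_derivative
        (\<lambda>v. h (f x) (frechet_derivative g (at x) v)
           + h (frechet_derivative f (at x) v) (g x))) (at x)"
      if "x \<in> U" for x
      using Ck_on_Suc_has_derivative[OF Suc.prems(1) that]
        Ck_on_Suc_has_derivative[OF Suc.prems(2) that]
      by (rule bounded_bilinear.FDERIV[OF assms(2)])
    show "Ck_on k U (\<lambda>x. h (f x) (frechet_derivative g (at x) v)
           + h (frechet_derivative f (at x) v) (g x))" for v
      using Suc.prems Suc.prems[THEN Ck_on_Suc_imp_Ck_on]
      by (intro Ck_on_add assms(1) Suc.IH) auto
  qed
qed

text \<open>Real powers of positive functions cover both reciprocals, for stereographic coordinates, and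
  the fractional power of time by which the ellipsoids shrink. The exponent changes in the induction,
  as the derivative involves the power with exponent \<open>e - 1\<close>.\<close>

lemma Ck_on_powr:
  fixes f :: "'a::real_normed_vector \<Rightarrow> real"
  assumes "open U" and pos: "\<And>x. x \<in> U \<Longrightarrow> 0 < f x"
  shows "Ck_on k U f \<Longrightarrow> Ck_on k U (\<lambda>x. f x powr e)"
proof (induction k arbitrary: e)
  case 0
  then show ?case
    using pos by (force intro: continuous_on_powr)
next
  case (Suc k)
  note f = Ck_on_Suc_imp_Ck_on[OF Suc.prems]
  show ?case
  proof (rule Ck_on_SucI[OF assms(1)])
    show "((\<lambda>x. f x powr e) has_derivative
        (\<lambda>v. (e * f x powr (e - 1)) * frechet_derivative f (at x) v)) (at x)" if "x \<in> U" for x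
    proof -
      have "((\<lambda>y. y powr e) has_derivative (\<lambda>h. (e * f x powr (e - 1)) * h)) (at (f x))"
        using has_real_derivative_powr[OF pos[OF that], of e]
        by (simp only: has_field_derivative_def)
      from has_derivative_compose[OF Ck_on_Suc_has_derivative[OF Suc.prems that] this]
      show ?thesis .
    qed
    show "Ck_on k U (\<lambda>x. (e * f x powr (e - 1)) * frechet_derivative f (at x) v)" for v
      using Suc.prems Suc.IH[OF f]
      by (intro Ck_on_bilinear[OF assms(1) bounded_bilinear_mult] Ck_on_const) auto
  qed
qed

section \<open>Transport and construction of local parametrizations\<close>

lemma inj_derivative_of_left_inverse:
  assumes X: "(X has_derivative X') (at u)" and Y: "(Y has_derivative Y') (at (X u))"
    and "open U" "u \<in> U" and inv: "\<And>w. w \<in> U \<Longrightarrow> Y (X w) = w"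
  shows "inj X'"
proof -
  have "((\<lambda>w. Y (X w)) has_derivative (\<lambda>h. Y' (X' h))) (at u)"
    using has_derivative_compose[OF X Y] .
  then have "((\<lambda>w. w) has_derivative (\<lambda>h. Y' (X' h))) (at u)"
    by (rule has_derivative_transform_within_open) (use assms in auto)
  then have "(\<lambda>h. Y' (X' h)) = (\<lambda>h. h)"
    using has_derivative_unique has_derivative_ident by blast
  then show ?thesis
    by (metis injI)
qed

lemma homeomorphism_affine:
  fixes L :: "'a::euclidean_space \<Rightarrow> 'a"
  assumes "linear L" "inj L"
  obtains A' where "homeomorphism UNIV UNIV (\<lambda>x. a + L x) A'"
proof -
  obtain L' where L': "linear L'" "\<And>x. L' (L x) = x" "\<And>x. L (L' x) = x"
    using linear_injective_isomorphism[OF assms] by blast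
  have bl: "bounded_linear L" and bl': "bounded_linear L'"
    using assms(1) L'(1) by (simp_all add: linear_conv_bounded_linear)
  have "homeomorphism UNIV UNIV (\<lambda>x. a + L x) (\<lambda>y. L' (y - a))"
  proof (rule homeomorphismI)
    show "continuous_on UNIV (\<lambda>x. a + L x)"
      by (rule continuous_on_add[OF continuous_on_const linear_continuous_on]) (rule bl)
    show "continuous_on UNIV (\<lambda>y. L' (y - a))"
      using bounded_linear.continuous_on[OF bl', of UNIV "\<lambda>y. y - a"]
      by (simp add: continuous_on_diff)
  qed (use L' in auto)
  then show thesis
    by (rule that)
qed

lemma local_parametrization_affine_image:
  fixes L :: "'n::finite ambient \<Rightarrow> 'n ambient"
  assumes par: "local_parametrization M U X" and "linear L" "inj L"
  shows "local_parametrization ((\<lambda>x. a + L x) ` M) U (\<lambda>u. a + L (X u))"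
proof -
  obtain A' where A': "homeomorphism UNIV UNIV (\<lambda>x. a + L x) A'"
    using homeomorphism_affine[OF assms(2,3)] .
  have U: "open U" and X: "\<And>k. Ck_on k U X" "openin (top_of_set M) (X ` U)"
      "\<And>u. u \<in> U \<Longrightarrow> inj (frechet_derivative X (at u))"
    using par by (auto simp: local_parametrization_def smooth_on_open_def)
  obtain Y where Y: "homeomorphism U (X ` U) X Y"
    using par by (auto simp: local_parametrization_def)
  have bl: "bounded_linear L"
    using assms(2) by (simp add: linear_conv_bounded_linear)
  have image: "(\<lambda>u. a + L (X u)) ` U = (\<lambda>x. a + L x) ` X ` U"
    by auto
  have "Ck_on k U (\<lambda>u. a + L (X u))" for k
    by (rule Ck_on_add[OF U Ck_on_const Ck_on_compose_bounded_linear[OF U bl X(1)]])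
  moreover have "inj (frechet_derivative (\<lambda>u. a + L (X u)) (at u))" if "u \<in> U" for u
  proof -
    have "((\<lambda>u. a + L (X u)) has_derivative (\<lambda>h. 0 + L (frechet_derivative X (at u) h))) (at u)"
      by (intro has_derivative_add has_derivative_const bounded_linear.has_derivative[OF bl]
          Ck_on_Suc_has_derivative[OF X(1) that])
    from frechet_derivative_at[OF this]
    have "frechet_derivative (\<lambda>u. a + L (X u)) (at u) = L \<circ> frechet_derivative X (at u)"
      by (simp add: comp_def)
    then show ?thesis
      using X(3)[OF that] assms(3) by (simp add: inj_compose)
  qed
  moreover have "openin (top_of_set ((\<lambda>x. a + L x) ` M)) ((\<lambda>u. a + L (X u)) ` U)"
    unfolding image
    using homeomorphism_imp_open_map[OF homeomorphism_of_subsets[OF A' subset_UNIV subset_UNIV refl] X(2)] .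
  moreover have "homeomorphism U ((\<lambda>u. a + L (X u)) ` U) (\<lambda>u. a + L (X u)) (Y \<circ> A')"
    using homeomorphism_compose[OF Y
        homeomorphism_of_subsets[OF A' subset_UNIV subset_UNIV refl, of "X ` U"]]
    unfolding image by (simp add: comp_def)
  ultimately show ?thesis
    using U by (auto simp: local_parametrization_def smooth_on_open_def)
qed

lemma smooth_hypersurface_affine_image:
  fixes L :: "'n::finite ambient \<Rightarrow> 'n ambient"
  assumes "smooth_hypersurface M" "linear L" "inj L"
  shows "smooth_hypersurface ((\<lambda>x. a + L x) ` M)"
  unfolding smooth_hypersurface_def
proof
  fix q assume "q \<in> (\<lambda>x. a + L x) ` M"
  then obtain p where p: "p \<in> M" "q = a + L p"
    by auto
  then obtain U X where "local_parametrization M U X" "p \<in> X ` U"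
    using assms(1) by (auto simp: smooth_hypersurface_def)
  then show "\<exists>U X. local_parametrization ((\<lambda>x. a + L x) ` M) U X \<and> q \<in> X ` U"
    using local_parametrization_affine_image[OF _ assms(2,3)] p by blast
qed

text \<open>The parametrization of the sphere inverse to the projection from the north pole \<open>(0, 1)\<close> to the
  equatorial hyperplane. The reciprocal is a real power so that \<open>Ck_on_powr\<close> applies.\<close>

definition stereographic :: "real^'n::finite \<Rightarrow> 'n ambient" where
  "stereographic u = ((1 + u \<bullet> u) powr -1) *\<^sub>R (2 *\<^sub>R u, u \<bullet> u - 1)"

lemma stereographic_eq:
  "stereographic u = ((2 / (1 + u \<bullet> u)) *\<^sub>R u, (u \<bullet> u - 1) / (1 + u \<bullet> u))"
  by (simp add: stereographic_def powr_minus_divide add_nonneg_nonneg)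

lemma Ck_on_stereographic: "Ck_on k UNIV (stereographic :: real^'n::finite \<Rightarrow> 'n ambient)"
proof -
  have sq: "Ck_on k UNIV (\<lambda>u :: real^'n. u \<bullet> u)"
    by (intro Ck_on_bilinear[OF _ bounded_bilinear_inner] Ck_on_bounded_linear
        bounded_linear_ident) auto
  have "Ck_on k UNIV (\<lambda>u :: real^'n. ((1 + u \<bullet> u) powr -1) *\<^sub>R
      ((2 *\<^sub>R u, 0) + ((u \<bullet> u) *\<^sub>R (0, 1) + (0, -1))) :: 'n ambient)"
  proof (intro Ck_on_bilinear[OF _ bounded_bilinear_scaleR] Ck_on_add Ck_on_powr Ck_on_const sq)
    show "Ck_on k UNIV (\<lambda>u :: real^'n. (2 *\<^sub>R u, 0 :: real))"
      by (intro Ck_on_bounded_linear bounded_linear_Pair bounded_linear_scaleR_right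
          bounded_linear_zero) auto
  qed (auto simp: add_pos_nonneg)
  moreover have "(\<lambda>u :: real^'n. ((1 + u \<bullet> u) powr -1) *\<^sub>R
      ((2 *\<^sub>R u, 0) + ((u \<bullet> u) *\<^sub>R (0, 1) + (0, -1)))) = (stereographic :: _ \<Rightarrow> 'n ambient)"
    by (auto simp: stereographic_def)
  ultimately show ?thesis
    by simp
qed

lemma sphere_Pair: "(x, s) \<in> sphere (0 :: 'n::finite ambient) 1 \<longleftrightarrow> x \<bullet> x + s * s = 1"
  by (simp add: norm_eq_1)

lemma stereographic_inverse:
  fixes u :: "real^'n::finite"
  shows "(1 / (1 - snd (stereographic u))) *\<^sub>R fst (stereographic u) = u"
proof -
  have pos: "0 < 1 + u \<bullet> u"
    by (simp add: add_pos_nonneg)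
  have "1 - (u \<bullet> u - 1) / (1 + u \<bullet> u) = 2 / (1 + u \<bullet> u)"
    using pos by (simp add: field_simps)
  then have "(1 / (1 - snd (stereographic u))) *\<^sub>R fst (stereographic u)
      = (1 / (2 / (1 + u \<bullet> u)) * (2 / (1 + u \<bullet> u))) *\<^sub>R u"
    by (simp only: stereographic_eq fst_conv snd_conv scaleR_scaleR)
  also have "1 / (2 / (1 + u \<bullet> u)) * (2 / (1 + u \<bullet> u)) = 1"
    using pos by (simp only: divide_divide_eq_right mult_1 times_divide_times_eq)
      (metis divide_self less_irrefl mult.commute mult_eq_0_iff zero_neq_numeral)
  finally show ?thesis
    by simp
qed

lemma range_stereographic:
  "range stereographic = sphere (0 :: 'n::finite ambient) 1 - {(0, 1)}"
proof (intro equalityI subsetI)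
  fix z :: "'n ambient"
  assume "z \<in> range stereographic"
  then obtain u where u: "z = stereographic u"
    by auto
  define q where "q = u \<bullet> u"
  have pos: "0 < 1 + q"
    by (simp add: q_def add_pos_nonneg)
  have "(2 / (1 + q))\<^sup>2 * q + ((q - 1) / (1 + q))\<^sup>2 = (4 * q + (q - 1)\<^sup>2) / (1 + q)\<^sup>2"
    by (simp add: power_divide add_divide_distrib)
  also have "4 * q + (q - 1)\<^sup>2 = (1 + q)\<^sup>2"
    by (simp add: power2_eq_square algebra_simps)
  finally have "(2 / (1 + q))\<^sup>2 * q + ((q - 1) / (1 + q))\<^sup>2 = 1"
    using pos by simp
  then have "z \<in> sphere 0 1"
    unfolding u stereographic_eq sphere_Pair by (simp add: q_def power2_eq_square)
  moreover have "(q - 1) / (1 + q) \<noteq> 1"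
    using pos by (simp add: field_simps)
  ultimately show "z \<in> sphere 0 1 - {(0, 1)}"
    by (auto simp: u stereographic_eq q_def)
next
  fix z :: "'n ambient"
  assume z: "z \<in> sphere 0 1 - {(0, 1)}"
  obtain x s where xs: "z = (x, s)"
    by force
  have sq: "x \<bullet> x = 1 - s * s"
    using z sphere_Pair[of x s] by (simp add: xs)
  have "s \<noteq> 1"
    using sq z xs by auto
  define u where "u = (1 / (1 - s)) *\<^sub>R x"
  have uu: "u \<bullet> u = (1 + s) / (1 - s)"
    using \<open>s \<noteq> 1\<close> by (simp add: u_def sq divide_simps) (simp add: algebra_simps)
  have "1 + u \<bullet> u = 2 / (1 - s)" "u \<bullet> u - 1 = 2 * s / (1 - s)"
    using \<open>s \<noteq> 1\<close> by (simp_all add: uu field_simps)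
  then have "stereographic u = z"
    using \<open>s \<noteq> 1\<close> by (simp add: stereographic_eq u_def xs)
  then show "z \<in> range stereographic"
    by blast
qed

lemma local_parametrization_stereographic:
  "local_parametrization (sphere (0 :: 'n::finite ambient) 1) UNIV stereographic"
proof -
  define Y :: "'n ambient \<Rightarrow> real^'n" where "Y z = (1 / (1 - snd z)) *\<^sub>R fst z" for z
  have inv: "Y (stereographic u) = u" for u
    by (simp add: Y_def stereographic_inverse)
  have south: "snd (stereographic u) \<noteq> 1" for u :: "real^'n"
  proof -
    have "0 < 1 + u \<bullet> u"
      by (simp add: add_pos_nonneg)
    then show ?thesis
      by (simp add: stereographic_eq field_simps)
  qed
  have "inj (frechet_derivative stereographic (at u))" for u :: "real^'n"
  proof -
    have "Y differentiable (at (stereographic u))"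
      unfolding Y_def using south[of u]
      by (intro differentiable_scaleR differentiable_divide differentiable_diff
          bounded_linear_imp_differentiable bounded_linear_fst bounded_linear_snd
          differentiable_const) auto
    then obtain Y' where "(Y has_derivative Y') (at (stereographic u))"
      by (auto simp: differentiable_def)
    then show ?thesis
      using inj_derivative_of_left_inverse[OF
          Ck_on_Suc_has_derivative[OF Ck_on_stereographic UNIV_I], of Y Y' u UNIV] inv by auto
  qed
  moreover have "openin (top_of_set (sphere 0 1)) (range (stereographic :: _ \<Rightarrow> 'n ambient))"
    unfolding range_stereographic by (simp add: openin_diff)
  moreover have "homeomorphism UNIV (range stereographic) stereographic Y"
  proof (rule homeomorphismI)
    show "continuous_on UNIV (stereographic :: _ \<Rightarrow> 'n ambient)"
      using Ck_on_stereographic[of 0] by simp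
    show "continuous_on (range stereographic) Y"
      unfolding Y_def using south by (intro continuous_intros) auto
  qed (auto simp: inv)
  ultimately show ?thesis
    by (auto simp: local_parametrization_def smooth_on_open_def Ck_on_stereographic)
qed

text \<open>The stereographic parametrization misses the north pole only, and its mirror image misses the
  south pole.\<close>

lemma smooth_hypersurface_sphere: "smooth_hypersurface (sphere (0 :: 'n::finite ambient) 1)"
  unfolding smooth_hypersurface_def
proof
  fix p :: "'n ambient"
  assume p: "p \<in> sphere 0 1"
  define refl :: "'n ambient \<Rightarrow> 'n ambient" where "refl z = (fst z, - snd z)" for z
  have refl: "linear refl" "inj refl"
    by (auto intro!: linearI injI simp: refl_def prod_eq_iff)
  have mem: "refl z \<in> sphere 0 1 \<longleftrightarrow> z \<in> sphere 0 1" for z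
    by (cases z) (simp add: refl_def norm_Pair)
  have invol: "refl (refl z) = z" for z
    by (simp add: refl_def)
  have sphere: "(\<lambda>z. 0 + refl z) ` sphere 0 1 = sphere 0 1"
  proof (intro equalityI subsetI)
    fix z :: "'n ambient"
    assume "z \<in> sphere 0 1"
    then have "refl z \<in> sphere 0 1" "z = 0 + refl (refl z)"
      using mem invol by simp_all
    then show "z \<in> (\<lambda>z. 0 + refl z) ` sphere 0 1"
      by (rule rev_image_eqI)
  next
    fix z :: "'n ambient"
    assume "z \<in> (\<lambda>z. 0 + refl z) ` sphere 0 1"
    then show "z \<in> sphere 0 1"
      using mem by force
  qed
  have par: "local_parametrization (sphere 0 1) UNIV (\<lambda>u. 0 + refl (stereographic u))"
    using local_parametrization_affine_image[OF local_parametrization_stereographic refl, of 0]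
    unfolding sphere .
  show "\<exists>U X. local_parametrization (sphere 0 1) U X \<and> p \<in> X ` U"
  proof (cases "p = (0, 1)")
    case True
    have "refl p \<in> range stereographic"
      unfolding range_stereographic using p mem[of p] True by (auto simp: refl_def)
    then have "p \<in> range (\<lambda>u. 0 + refl (stereographic u))"
      using invol by (metis (no_types, lifting) add_0 image_iff)
    then show ?thesis
      using par by blast
  next
    case False
    then have "p \<in> range stereographic"
      unfolding range_stereographic using p by auto
    then show ?thesis
      using local_parametrization_stereographic by blast
  qed
qed

section \<open>Linear algebra\<close>

lemma transpose_nth: "transpose A $ i $ j = A $ j $ i"
  by (simp add: transpose_def)

text \<open>In an orthonormal basis that contains the direction of \<open>x\<close>, the transpose of the matrix differs
  from the identity in a single column, so that Cramer's rule gives its determinant.\<close>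

lemma det_rank_one_update:
  fixes x y :: "real^'n::finite"
  shows "det (mat 1 + (\<chi> i j. x $ i * y $ j)) = 1 + x \<bullet> y"
proof (cases "x = 0")
  case True
  have "(\<chi> i j. (0 :: real^'n) $ i * y $ j) = 0"
    by (simp add: vec_eq_iff)
  then show ?thesis
    using True by simp
next
  case False
  define a where "a = (1 / norm x) *\<^sub>R x"
  have "norm a = 1"
    using False by (simp add: a_def)
  define k :: 'n where "k = (SOME k. True)"
  obtain Q where Q: "orthogonal_matrix Q" "Q *v axis k 1 = a"
    using orthogonal_matrix_exists_basis[OF \<open>norm a = 1\<close>] by blast
  have xQ: "x $ i = norm x * Q $ i $ k" for i
  proof -
    have "a $ i = Q $ i $ k"
      by (simp flip: Q(2) add: matrix_vector_mult_basis column_def)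
    then show ?thesis
      using False by (simp add: a_def field_simps)
  qed
  define z where "z = transpose Q *v y"
  have QQ: "transpose Q ** Q = mat 1" "Q ** transpose Q = mat 1"
    using Q(1) by (auto simp: orthogonal_matrix_def)
  have detQ: "det (transpose Q) * det Q = 1"
    using arg_cong[OF QQ(1), of det] by (simp add: det_mul)
  define R :: "real^'n^'n" where "R = (\<chi> i j. (if j = k then norm x * z $ i else 0))"
  have R: "mat 1 + R = (\<chi> i j. if j = k then (mat 1 *v (axis k 1 + norm x *\<^sub>R z)) $ i else mat 1 $ i $ j)"
    unfolding matrix_vector_mul_lid by (auto simp: R_def vec_eq_iff mat_def axis_def)
  have QRQ: "Q ** R ** transpose Q = transpose (\<chi> i j. x $ i * y $ j)"
  proof -
    have "Q *v z = y"
      unfolding z_def matrix_vector_mul_assoc QQ by simp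
    then have "(\<Sum>l\<in>UNIV. Q $ i $ l * z $ l) = y $ i" for i
      by (simp add: matrix_vector_mult_def vec_eq_iff)
    moreover have "(\<Sum>l\<in>UNIV. Q $ i $ l * (norm x * z $ l))
        = norm x * (\<Sum>l\<in>UNIV. Q $ i $ l * z $ l)" for i
      by (simp add: sum_distrib_left mult.left_commute)
    ultimately have QR: "Q ** R = (\<chi> i j. if j = k then norm x * y $ i else 0)"
      by (simp add: matrix_matrix_mult_def R_def vec_eq_iff)
    have "(Q ** R ** transpose Q) $ i $ j = norm x * y $ i * Q $ j $ k" for i j
    proof -
      have "(Q ** R ** transpose Q) $ i $ j
          = (\<Sum>l\<in>UNIV. (if l = k then norm x * y $ i else 0) * Q $ j $ l)"
        by (simp only: QR matrix_matrix_mult_def[of _ "transpose Q"] transpose_nth vec_lambda_beta)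
      also have "\<dots> = (\<Sum>l\<in>UNIV. if l = k then norm x * y $ i * Q $ j $ k else 0)"
        by (rule sum.cong) auto
      finally show ?thesis
        by simp
    qed
    then show ?thesis
      by (simp only: vec_eq_iff transpose_nth vec_lambda_beta) (simp only: xQ mult_ac simp_thms)
  qed
  have "Q ** (mat 1 + R) ** transpose Q = mat 1 + transpose (\<chi> i j. x $ i * y $ j)"
  proof -
    have "(A + C) ** D = A ** D + C ** D" for A C D :: "real^'n^'n"
      by (simp add: vec_eq_iff matrix_matrix_mult_def distrib_right sum.distrib)
    then show ?thesis
      by (simp only: matrix_add_ldistrib matrix_mul_rid QQ QRQ)
  qed
  also have "\<dots> = transpose (mat 1 + (\<chi> i j. x $ i * y $ j))"
    by (simp add: vec_eq_iff transpose_def mat_def)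
  finally have "det (mat 1 + (\<chi> i j. x $ i * y $ j)) = det (Q ** (mat 1 + R) ** transpose Q)"
    by (simp add: det_transpose)
  also have "\<dots> = det (mat 1 + R)"
    using detQ by (simp add: det_mul mult.assoc)
  also have "\<dots> = (axis k 1 + norm x *\<^sub>R z) $ k"
    unfolding R cramer_lemma by simp
  also have "\<dots> = 1 + norm x * (\<Sum>i\<in>UNIV. Q $ i $ k * y $ i)"
    by (simp add: z_def matrix_vector_mult_def transpose_def axis_def)
  also have "\<dots> = 1 + x \<bullet> y"
    by (simp add: inner_vec_def xQ sum_distrib_left algebra_simps)
  finally show ?thesis .
qed

lemma det_scaleR_matrix:
  fixes A :: "real^'n::finite^'n"
  shows "det (a *\<^sub>R A) = a ^ CARD('n) * det A"
proof -
  have "a *\<^sub>R A = matrix ((*\<^sub>R) a) ** A"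
    by (simp add: matrix_scaleR vec_eq_iff matrix_matrix_mult_def mat_def if_distrib
        if_distribR cong: if_cong)
  then show ?thesis
    by (simp add: det_mul)
qed

lemma invertible_of_positive_definite:
  fixes A :: "real^'n::finite^'n"
  assumes "\<And>x. x \<noteq> 0 \<Longrightarrow> 0 < x \<bullet> (A *v x)"
  shows "invertible A"
proof -
  have "x = 0" if "A *v x = 0" for x
    using assms[of x] that by force
  then show ?thesis
    by (metis invertible_left_inverse matrix_left_invertible_ker)
qed

lemma matrix_inv_mult:
  assumes "invertible A"
  shows "A ** matrix_inv A = mat 1" "matrix_inv A ** A = mat 1"
  using someI_ex[OF assms[unfolded invertible_def]] by (auto simp: matrix_inv_def)

text \<open>The orthogonal complement of the image has dimension one, as the domain and the codomain
  differ in dimension by one.\<close>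

lemma tangential_plus_normal_decomposition:
  fixes D :: "real^'n::finite \<Rightarrow> 'n ambient"
  assumes "linear D" "inj D" "norm \<nu> = 1" and perp: "\<And>h. D h \<bullet> \<nu> = 0"
  obtains h where "y = D h + (y \<bullet> \<nu>) *\<^sub>R \<nu>"
proof -
  have \<nu>: "\<nu> \<bullet> \<nu> = 1"
    using assms(3) by (simp add: norm_eq_1)
  define L :: "'n ambient \<Rightarrow> 'n ambient" where "L z = D (fst z) + snd z *\<^sub>R \<nu>" for z
  have "linear L"
    using assms(1)
    by (intro linearI) (simp_all add: L_def linear_add linear_scale algebra_simps)
  moreover have "inj L"
  proof -
    have "z = 0" if "L z = 0" for z
    proof -
      have "L z \<bullet> \<nu> = snd z"
        by (simp add: L_def inner_add_left perp \<nu>)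
      then have "snd z = 0"
        using that by simp
      then have "D (fst z) = 0"
        using that by (simp add: L_def)
      then show "z = 0"
        using assms(1,2) \<open>snd z = 0\<close> by (simp add: linear_injective_0 prod_eq_iff)
    qed
    then show ?thesis
      using linear_injective_0[OF \<open>linear L\<close>] by blast
  qed
  ultimately obtain z where z: "y = L z"
    using linear_injective_imp_surjective by (metis surjE)
  then have "y \<bullet> \<nu> = snd z"
    by (simp add: L_def inner_add_left perp \<nu>)
  then show thesis
    using that[of "fst z"] z by (simp add: L_def)
qed

lemma linear_eq_sum_axis:
  fixes D :: "real^'n::finite \<Rightarrow> 'b::real_vector"
  assumes "linear D"
  shows "D h = (\<Sum>i\<in>UNIV. h $ i *\<^sub>R D (axis i 1))"
proof -
  have "D h = D (\<Sum>i\<in>UNIV. h $ i *\<^sub>R axis i 1)"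
    by (simp add: basis_expansion flip: scalar_mult_eq_scaleR)
  then show ?thesis
    using assms by (simp add: linear_sum linear_scale)
qed

lemma inner_matrix_vector_mult:
  fixes A :: "real^'n::finite^'n"
  shows "x \<bullet> (A *v y) = (\<Sum>i\<in>UNIV. \<Sum>j\<in>UNIV. x $ i * y $ j * A $ i $ j)"
  by (simp add: inner_vec_def matrix_vector_mult_def sum_distrib_left algebra_simps)

text \<open>A matrix whose entries are the values of a bilinear form on the images of the standard
  basis vectors represents the pullback of that form.\<close>

lemma pullback_bilinear_form:
  fixes D :: "real^'n::finite \<Rightarrow> 'b::real_vector" and A :: "real^'n^'n"
  assumes "linear D" "bilinear q" and "\<And>i j. A $ i $ j = q (D (axis i 1)) (D (axis j 1))"
  shows "x \<bullet> (A *v y) = q (D x) (D y)"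
proof -
  have "q (D x) (D y)
      = q (\<Sum>i\<in>UNIV. x $ i *\<^sub>R D (axis i 1)) (\<Sum>j\<in>UNIV. y $ j *\<^sub>R D (axis j 1))"
    by (simp flip: linear_eq_sum_axis[OF assms(1)])
  also have "\<dots> = (\<Sum>(i, j)\<in>UNIV \<times> UNIV. q (x $ i *\<^sub>R D (axis i 1)) (y $ j *\<^sub>R D (axis j 1)))"
    by (rule bilinear_sum[OF assms(2)])
  also have "\<dots> = (\<Sum>(i, j)\<in>UNIV \<times> UNIV. x $ i * y $ j * A $ i $ j)"
    by (intro sum.cong refl) (auto simp: assms(3) bilinear_lmul[OF assms(2)] bilinear_rmul[OF assms(2)] mult_ac)
  finally show ?thesis
    by (simp add: inner_matrix_vector_mult sum.cartesian_product)
qed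

section \<open>Ellipsoids of revolution\<close>

text \<open>For a unit vector \<open>v\<close> this map scales the axis spanned by \<open>v\<close> by \<open>m\<close> and fixes the orthogonal
  complement of \<open>v\<close> pointwise; in particular it is self-adjoint and its determinant is \<open>m\<close>.\<close>

definition axial_map :: "'a::real_inner \<Rightarrow> real \<Rightarrow> 'a \<Rightarrow> 'a" where
  "axial_map v m x = x + ((m - 1) * (x \<bullet> v)) *\<^sub>R v"

lemma linear_axial_map: "linear (axial_map v m)"
  by (intro linearI) (simp_all add: axial_map_def algebra_simps inner_add_left)

lemma inner_axial_map: "axial_map v m x \<bullet> y = x \<bullet> axial_map v m y"
  by (simp add: axial_map_def inner_add_left inner_add_right inner_commute)

lemma inner_axial_map_commute: "x \<bullet> axial_map v m y = y \<bullet> axial_map v m x"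
  by (simp add: axial_map_def inner_add_right inner_commute)

lemma axial_map_axial_map:
  assumes "norm v = 1"
  shows "axial_map v a (axial_map v b x) = axial_map v (a * b) x"
proof -
  have "v \<bullet> v = 1"
    using assms by (simp add: norm_eq_1)
  then show ?thesis
    by (simp add: axial_map_def inner_add_left) (simp add: algebra_simps)
qed

lemma axial_map_1 [simp]: "axial_map v 1 = (\<lambda>x. x)"
  by (simp add: axial_map_def fun_eq_iff)

lemma axial_map_positive:
  fixes v x :: "'a::real_inner"
  assumes "norm v = 1" "0 < m" "x \<noteq> 0"
  shows "0 < x \<bullet> axial_map v m x"
proof -
  have le: "(x \<bullet> v)\<^sup>2 \<le> x \<bullet> x"
    using Cauchy_Schwarz_ineq[of x v] assms(1) by (simp add: norm_eq_1)
  have eq: "x \<bullet> axial_map v m x = (x \<bullet> x - (x \<bullet> v)\<^sup>2) + m * (x \<bullet> v)\<^sup>2"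
    by (simp add: axial_map_def inner_add_right power2_eq_square algebra_simps)
  show ?thesis
  proof (cases "x \<bullet> v = 0")
    case True
    then show ?thesis
      using assms(3) by (simp add: eq)
  next
    case False
    then have "0 < m * (x \<bullet> v)\<^sup>2"
      using assms(2) by simp
    then show ?thesis
      using le eq by linarith
  qed
qed

text \<open>The semiaxis in direction \<open>v\<close> is \<open>r / sqrt m\<close>, the others are \<open>r\<close>. Hence small \<open>m\<close> means a long
  ellipsoid, and a homothety about \<open>c\<close> changes only \<open>r\<close>.\<close>

definition ellipsoid :: "'a::real_inner \<Rightarrow> real \<Rightarrow> 'a \<Rightarrow> real \<Rightarrow> 'a set" where
  "ellipsoid v m c r = {x. (x - c) \<bullet> axial_map v m (x - c) < r\<^sup>2}"

definition ellipsoid_semiaxes :: "'a::real_inner \<Rightarrow> real \<Rightarrow> real \<Rightarrow> 'a \<Rightarrow> 'a" where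
  "ellipsoid_semiaxes v m r y = r *\<^sub>R axial_map v (1 / sqrt m) y"

context
  fixes v :: "'a::euclidean_space" and m r :: real
  assumes v: "norm v = 1" and m: "0 < m" and r: "0 < r"
begin

lemma linear_ellipsoid_semiaxes: "linear (ellipsoid_semiaxes v m r)"
  unfolding ellipsoid_semiaxes_def by (intro linear_compose_scale_right linear_axial_map)

lemma ellipsoid_semiaxes_inverse:
  "axial_map v (sqrt m) ((1 / r) *\<^sub>R ellipsoid_semiaxes v m r y) = y"
  "ellipsoid_semiaxes v m r (axial_map v (sqrt m) ((1 / r) *\<^sub>R x)) = x"
  using m r by (simp_all add: ellipsoid_semiaxes_def axial_map_axial_map[OF v]
      linear_scale[OF linear_axial_map])

lemma inj_ellipsoid_semiaxes: "inj (ellipsoid_semiaxes v m r)"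
  by (metis ellipsoid_semiaxes_inverse(1) injI)

lemma ellipsoid_form_semiaxes:
  "ellipsoid_semiaxes v m r y \<bullet> axial_map v m (ellipsoid_semiaxes v m r y) = r\<^sup>2 * (norm y)\<^sup>2"
proof -
  have "1 / sqrt m * m * (1 / sqrt m) = 1"
    using m by (simp add: field_simps)
  then have "axial_map v (1 / sqrt m) y \<bullet> axial_map v m (axial_map v (1 / sqrt m) y) = y \<bullet> y"
    by (simp add: inner_axial_map axial_map_axial_map[OF v] mult.assoc)
  then show ?thesis
    by (simp add: ellipsoid_semiaxes_def linear_scale[OF linear_axial_map] power2_norm_eq_inner)
      (simp add: power2_eq_square)
qed

text \<open>The condition \<open>P\<close> is arbitrary so that the open ball and the sphere are covered at once.\<close>

lemma affine_image_of_norm_condition: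
  "(\<lambda>y. c + ellipsoid_semiaxes v m r y) ` {y. P ((norm y)\<^sup>2)}
    = {x. P (((x - c) \<bullet> axial_map v m (x - c)) / r\<^sup>2)}" (is "?f ` ?A = ?B")
proof (intro equalityI subsetI)
  fix x assume "x \<in> ?f ` ?A"
  then show "x \<in> ?B"
    using r by (auto simp: ellipsoid_form_semiaxes)
next
  fix x assume x: "x \<in> ?B"
  define y where "y = axial_map v (sqrt m) ((1 / r) *\<^sub>R (x - c))"
  have y: "ellipsoid_semiaxes v m r y = x - c"
    by (simp add: y_def ellipsoid_semiaxes_inverse)
  then have "(x - c) \<bullet> axial_map v m (x - c) = r\<^sup>2 * (norm y)\<^sup>2"
    by (simp flip: ellipsoid_form_semiaxes)
  then have "y \<in> ?A"
    using x r by simp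
  moreover have "x = ?f y"
    by (simp add: y)
  ultimately show "x \<in> ?f ` ?A"
    by (rule rev_image_eqI)
qed

lemma ellipsoid_eq_image_ball:
  "ellipsoid v m c r = (\<lambda>y. c + ellipsoid_semiaxes v m r y) ` ball 0 1"
proof -
  have "ball 0 1 = {y :: 'a. (norm y)\<^sup>2 < 1}"
    by (simp add: set_eq_iff abs_square_less_1)
  then show ?thesis
    using r affine_image_of_norm_condition[of c "\<lambda>t. t < 1"] by (simp add: ellipsoid_def)
qed

lemma frontier_ellipsoid_eq_image_sphere:
  "frontier (ellipsoid v m c r) = (\<lambda>y. c + ellipsoid_semiaxes v m r y) ` sphere 0 1"
proof -
  let ?L = "ellipsoid_semiaxes v m r"
  have "frontier (ellipsoid v m c r) = frontier ((+) c ` ?L ` ball 0 1)"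
    by (simp add: ellipsoid_eq_image_ball image_image)
  also have "\<dots> = (+) c ` frontier (?L ` ball 0 1)"
    by (rule frontier_translation)
  also have "frontier (?L ` ball 0 1) = ?L ` frontier (ball 0 1)"
    unfolding frontier_def
    by (simp only: interior_injective_linear_image[OF linear_ellipsoid_semiaxes inj_ellipsoid_semiaxes]
        closure_injective_linear_image[OF linear_ellipsoid_semiaxes inj_ellipsoid_semiaxes, symmetric]
        image_set_diff[OF inj_ellipsoid_semiaxes])
  finally show ?thesis
    by (simp add: image_image)
qed

lemma frontier_ellipsoid:
  "frontier (ellipsoid v m c r) = {x. (x - c) \<bullet> axial_map v m (x - c) = r\<^sup>2}"
proof -
  have "sphere 0 1 = {y :: 'a. (norm y)\<^sup>2 = 1}"
    by (simp add: set_eq_iff abs_square_eq_1)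
  then show ?thesis
    using r affine_image_of_norm_condition[of c "\<lambda>t. t = 1"]
    by (auto simp: frontier_ellipsoid_eq_image_sphere)
qed

lemma center_in_ellipsoid: "c \<in> ellipsoid v m c r"
  using r by (simp add: ellipsoid_def axial_map_def)

lemma open_ellipsoid: "open (ellipsoid v m c r)"
proof -
  have "ellipsoid v m c r = (+) c ` ellipsoid_semiaxes v m r ` ball 0 1"
    by (simp add: ellipsoid_eq_image_ball image_image)
  then show ?thesis
    using linear_ellipsoid_semiaxes inj_ellipsoid_semiaxes
    by (simp add: open_translation open_surjective_linear_image linear_injective_imp_surjective)
qed

lemma convex_ellipsoid: "convex (ellipsoid v m c r)"
proof -
  have "ellipsoid v m c r = (+) c ` ellipsoid_semiaxes v m r ` ball 0 1"
    by (simp add: ellipsoid_eq_image_ball image_image)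
  then show ?thesis
    by (simp add: convex_translation convex_linear_image linear_ellipsoid_semiaxes)
qed

lemma bounded_ellipsoid: "bounded (ellipsoid v m c r)"
proof -
  have "ellipsoid v m c r = (+) c ` ellipsoid_semiaxes v m r ` ball 0 1"
    by (simp add: ellipsoid_eq_image_ball image_image)
  then show ?thesis
    using bounded_linear_image[OF bounded_ball] linear_ellipsoid_semiaxes
    by (metis bounded_translation linear_conv_bounded_linear)
qed

end

lemma smooth_hypersurface_frontier_ellipsoid:
  fixes v :: "'n::finite ambient"
  assumes "norm v = 1" "0 < m" "0 < r"
  shows "smooth_hypersurface (frontier (ellipsoid v m c r))"
  unfolding frontier_ellipsoid_eq_image_sphere[OF assms]
  by (intro smooth_hypersurface_affine_image smooth_hypersurface_sphere
      linear_ellipsoid_semiaxes inj_ellipsoid_semiaxes assms)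

section \<open>The affine normal of an ellipsoid\<close>

text \<open>The flow equation has to hold in every local parametrization, so the affine normal is computed
  in an arbitrary one. Everything is expressed by the conormal \<open>B (X u - c)\<close>, which is half the
  gradient of the quadratic form defining the ellipsoid.\<close>

locale ellipsoid_chart =
  fixes v c :: "'n::finite ambient" and m r :: real and U X
  assumes norm_v: "norm v = 1" and m_pos: "0 < m" and r_pos: "0 < r"
    and chart: "local_parametrization (frontier (ellipsoid v m c r)) U X"
begin

abbreviation B where "B \<equiv> axial_map v m"

abbreviation DX where "DX u \<equiv> frechet_derivative X (at u)"

definition conormal where "conormal u = B (X u - c)"

definition unit_normal where "unit_normal u = - ((1 / norm (conormal u)) *\<^sub>R conormal u)"

lemma open_U: "open U"
  using chart by (simp add: local_parametrization_def)

lemma Ck_on_X: "Ck_on k U X"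
  using chart by (simp add: local_parametrization_def smooth_on_open_def)

lemma bounded_linear_B: "bounded_linear B"
  using linear_axial_map[of v m] by (simp add: linear_conv_bounded_linear)

lemma has_derivative_X: "u \<in> U \<Longrightarrow> (X has_derivative DX u) (at u)"
  by (rule Ck_on_Suc_has_derivative[OF Ck_on_X])

lemma linear_DX: "u \<in> U \<Longrightarrow> linear (DX u)"
  using has_derivative_X has_derivative_linear by blast

lemma inj_DX: "u \<in> U \<Longrightarrow> inj (DX u)"
  using chart by (simp add: local_parametrization_def)

lemma DX_axis: "DX u (axis i 1) = pderiv_at i X u"
  by (simp add: pderiv_at_def)

lemma DX_eq_sum: "u \<in> U \<Longrightarrow> DX u h = (\<Sum>i\<in>UNIV. h $ i *\<^sub>R pderiv_at i X u)"
  using linear_eq_sum_axis[OF linear_DX] by (simp add: DX_axis)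

lemma X_in_frontier:
  assumes "u \<in> U"
  shows "(X u - c) \<bullet> conormal u = r\<^sup>2"
proof -
  have "X ` U \<subseteq> frontier (ellipsoid v m c r)"
    using chart openin_imp_subset by (metis local_parametrization_def)
  then show ?thesis
    using assms by (auto simp: frontier_ellipsoid[OF norm_v m_pos r_pos] conormal_def)
qed

lemma norm_conormal_pos:
  assumes "u \<in> U"
  shows "0 < norm (conormal u)"
  using X_in_frontier[OF assms] r_pos by auto

lemma conormal_has_derivative:
  assumes "u \<in> U"
  shows "(conormal has_derivative (\<lambda>h. B (DX u h))) (at u)"
proof -
  have "((\<lambda>u. X u - c) has_derivative (\<lambda>h. DX u h - 0)) (at u)"
    by (intro has_derivative_diff has_derivative_X assms has_derivative_const)
  from bounded_linear.has_derivative[OF bounded_linear_B this] show ?thesis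
    by (simp add: conormal_def[abs_def])
qed

text \<open>The quadratic form \<open>\<lambda>x. (x - c) \<bullet> B (x - c)\<close> is constant along the parametrization.\<close>

lemma DX_orthogonal_conormal:
  assumes "u \<in> U"
  shows "DX u h \<bullet> conormal u = 0"
proof -
  have "((\<lambda>u. X u - c) has_derivative (\<lambda>h. DX u h - 0)) (at u)"
    by (intro has_derivative_diff has_derivative_X assms has_derivative_const)
  from has_derivative_inner[OF this conormal_has_derivative[OF assms]]
  have "((\<lambda>u. (X u - c) \<bullet> conormal u) has_derivative
      (\<lambda>h. (X u - c) \<bullet> B (DX u h) + DX u h \<bullet> conormal u)) (at u)"
    by simp
  then have "((\<lambda>u. r\<^sup>2) has_derivative
      (\<lambda>h. (X u - c) \<bullet> B (DX u h) + DX u h \<bullet> conormal u)) (at u)"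
    by (rule has_derivative_transform_within_open) (use open_U assms X_in_frontier in auto)
  from has_derivative_unique[OF this has_derivative_const]
  have "(X u - c) \<bullet> B (DX u h) + DX u h \<bullet> conormal u = 0"
    by (rule fun_cong)
  moreover have "(X u - c) \<bullet> B (DX u h) = DX u h \<bullet> conormal u"
    unfolding conormal_def by (rule inner_axial_map_commute)
  ultimately show ?thesis
    by simp
qed

lemma pderiv_orthogonal_conormal: "u \<in> U \<Longrightarrow> pderiv_at i X u \<bullet> conormal u = 0"
  using DX_orthogonal_conormal[of u "axis i 1"] by (simp add: DX_axis)

text \<open>This identity results from differentiating the orthogonality of \<open>pderiv_at j X\<close> and the
  conormal. It reduces the second fundamental form to first derivatives of \<open>X\<close>.\<close>

lemma second_derivative_conormal:
  assumes "u \<in> U"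
  shows "pderiv_at i (pderiv_at j X) u \<bullet> conormal u = - (pderiv_at i X u \<bullet> B (pderiv_at j X u))"
proof -
  have "Ck_on (Suc 0) U (pderiv_at j X)"
    using Ck_on_X[of "Suc (Suc 0)"] by (simp add: pderiv_at_def[abs_def])
  from has_derivative_inner[OF Ck_on_Suc_has_derivative[OF this assms]
      conormal_has_derivative[OF assms]]
  have "((\<lambda>u. 0) has_derivative
      (\<lambda>h. pderiv_at j X u \<bullet> B (DX u h)
        + frechet_derivative (pderiv_at j X) (at u) h \<bullet> conormal u)) (at u)"
    by (rule has_derivative_transform_within_open)
      (use open_U assms pderiv_orthogonal_conormal in auto)
  from has_derivative_unique[OF this has_derivative_const]
  have "pderiv_at j X u \<bullet> B (DX u (axis i 1))
      + frechet_derivative (pderiv_at j X) (at u) (axis i 1) \<bullet> conormal u = 0"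
    by (rule fun_cong)
  then show ?thesis
    by (simp add: DX_axis pderiv_at_def[of i "pderiv_at j X"]
        inner_axial_map_commute[of "pderiv_at j X u"])
qed

lemma norm_unit_normal: "u \<in> U \<Longrightarrow> norm (unit_normal u) = 1"
  using norm_conormal_pos by (simp add: unit_normal_def)

lemma DX_orthogonal_unit_normal: "u \<in> U \<Longrightarrow> DX u h \<bullet> unit_normal u = 0"
  using DX_orthogonal_conormal by (simp add: unit_normal_def)

lemma tangential_plus_normal:
  assumes "u \<in> U"
  obtains h where "y = DX u h + (y \<bullet> unit_normal u) *\<^sub>R unit_normal u"
  using tangential_plus_normal_decomposition[OF linear_DX[OF assms] inj_DX[OF assms]
      norm_unit_normal[OF assms] DX_orthogonal_unit_normal[OF assms]] by blast

lemma orthogonal_to_tangent_space: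
  assumes u: "u \<in> U" and perp: "\<And>i. pderiv_at i X u \<bullet> y = 0"
  shows "y = (y \<bullet> unit_normal u) *\<^sub>R unit_normal u"
proof -
  obtain h where h: "y = DX u h + (y \<bullet> unit_normal u) *\<^sub>R unit_normal u"
    using tangential_plus_normal[OF u] .
  have "DX u h \<bullet> y = 0"
    using perp by (simp add: DX_eq_sum[OF u] inner_sum_left)
  moreover have "DX u h \<bullet> y = DX u h \<bullet> DX u h"
    by (subst h) (simp add: inner_add_right DX_orthogonal_unit_normal[OF u])
  ultimately have "DX u h = 0"
    by simp
  then show ?thesis
    using h by simp
qed

lemma form_along_unit_normal:
  assumes "u \<in> U"
  shows "(X u + s *\<^sub>R unit_normal u - c) \<bullet> B (X u + s *\<^sub>R unit_normal u - c)
    = r\<^sup>2 - 2 * s * norm (conormal u) + s\<^sup>2 * (unit_normal u \<bullet> B (unit_normal u))"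
proof -
  let ?y = "X u - c" and ?\<nu> = "unit_normal u"
  have eq: "X u + s *\<^sub>R ?\<nu> - c = ?y + s *\<^sub>R ?\<nu>"
    by simp
  have "?y \<bullet> B ?\<nu> = ?\<nu> \<bullet> B ?y"
    by (rule inner_axial_map_commute)
  moreover have "(y + s *\<^sub>R z) \<bullet> B (y + s *\<^sub>R z)
      = y \<bullet> B y + s * (y \<bullet> B z) + s * (z \<bullet> B y) + s\<^sup>2 * (z \<bullet> B z)" for y z
    by (simp add: linear_add[OF linear_axial_map] linear_scale[OF linear_axial_map]
        inner_add_left inner_add_right power2_eq_square algebra_simps)
  ultimately have "(?y + s *\<^sub>R ?\<nu>) \<bullet> B (?y + s *\<^sub>R ?\<nu>)
      = ?y \<bullet> B ?y + 2 * s * (?\<nu> \<bullet> B ?y) + s\<^sup>2 * (?\<nu> \<bullet> B ?\<nu>)"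
    by simp
  moreover have "?\<nu> \<bullet> B ?y = - norm (conormal u)"
    using norm_conormal_pos[OF assms]
    by (simp add: unit_normal_def flip: conormal_def)
      (simp add: dot_square_norm power2_eq_square)
  moreover have "?y \<bullet> B ?y = r\<^sup>2"
    using X_in_frontier[OF assms] by (simp add: conormal_def)
  ultimately show ?thesis
    by (simp add: eq)
qed

text \<open>Only two unit vectors are orthogonal to the tangent space, and to first order in \<open>s\<close> a
  displacement by \<open>s\<close> along them changes the quadratic form by \<open>2 * s * norm (conormal u)\<close> with
  opposite signs.\<close>

lemma inward_normal_eq:
  assumes u: "u \<in> U"
  shows "inward_normal (ellipsoid v m c r) X u = unit_normal u"
  unfolding inward_normal_def
proof (rule the_equality)
  let ?\<nu> = "unit_normal u" and ?w = "norm (conormal u)"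
  define k where "k = ?\<nu> \<bullet> B ?\<nu>"
  have k: "0 < k"
    unfolding k_def using norm_unit_normal[OF u]
    by (intro axial_map_positive norm_v m_pos) auto
  have mem: "X u + s *\<^sub>R ?\<nu> \<in> ellipsoid v m c r \<longleftrightarrow> s * (s * k) < s * (2 * ?w)" for s
  proof -
    have "s\<^sup>2 * k = s * (s * k)" "2 * s * ?w = s * (2 * ?w)"
      by (simp_all add: power2_eq_square)
    then show ?thesis
      by (auto simp: ellipsoid_def form_along_unit_normal[OF u] simp flip: k_def)
  qed
  have "\<forall>\<^sub>F s in at_right 0. X u + s *\<^sub>R ?\<nu> \<in> ellipsoid v m c r"
    unfolding eventually_at_right_field mem
    using k norm_conormal_pos[OF u] by (intro exI[of _ "2 * ?w / k"]) (auto simp: field_simps)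
  moreover have "pderiv_at i X u \<bullet> ?\<nu> = 0" for i
    using DX_orthogonal_unit_normal[OF u, of "axis i 1"] by (simp add: DX_axis)
  ultimately show "norm ?\<nu> = 1 \<and> (\<forall>i. pderiv_at i X u \<bullet> ?\<nu> = 0)
      \<and> (\<forall>\<^sub>F s in at_right 0. X u + s *\<^sub>R ?\<nu> \<in> ellipsoid v m c r)"
    using norm_unit_normal[OF u] by simp
  fix \<nu>
  assume \<nu>: "norm \<nu> = 1 \<and> (\<forall>i. pderiv_at i X u \<bullet> \<nu> = 0)
      \<and> (\<forall>\<^sub>F s in at_right 0. X u + s *\<^sub>R \<nu> \<in> ellipsoid v m c r)"
  define a where "a = \<nu> \<bullet> ?\<nu>"
  have a: "\<nu> = a *\<^sub>R ?\<nu>"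
    unfolding a_def by (rule orthogonal_to_tangent_space[OF u]) (use \<nu> in simp)
  then have "\<bar>a\<bar> = 1"
    using \<nu> norm_unit_normal[OF u] by (metis mult.right_neutral norm_scaleR)
  moreover have "a \<noteq> -1"
  proof
    assume "a = -1"
    have "\<forall>\<^sub>F s in at_right 0. X u + s *\<^sub>R \<nu> \<in> ellipsoid v m c r \<and> (0::real) < s"
      using \<nu> eventually_at_right_less by (intro eventually_conj) auto
    then obtain s where s: "X u + (- s) *\<^sub>R ?\<nu> \<in> ellipsoid v m c r" "0 < s"
      using eventually_happens[of _ "at_right (0::real)"] a \<open>a = -1\<close> by force
    have "0 < s * (s * k) + s * (2 * ?w)"
      using k s(2) norm_conormal_pos[OF u] by (intro add_pos_pos mult_pos_pos) auto
    then show False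
      using s(1) unfolding mem by (simp add: algebra_simps)
  qed
  ultimately have "a = 1"
    by linarith
  then show "\<nu> = ?\<nu>"
    using a by simp
qed

lemma second_form_entry:
  assumes "u \<in> U"
  shows "second_form (ellipsoid v m c r) X u $ i $ j
    = (pderiv_at i X u \<bullet> B (pderiv_at j X u)) / norm (conormal u)"
  using second_derivative_conormal[OF assms, of i j]
  by (simp add: second_form_def inward_normal_eq[OF assms] unit_normal_def)

lemma second_form_eq_pullback:
  assumes "u \<in> U"
  shows "x \<bullet> (second_form (ellipsoid v m c r) X u *v y)
    = (DX u x \<bullet> B (DX u y)) / norm (conormal u)"
proof (rule pullback_bilinear_form[OF linear_DX[OF assms]])
  show "bilinear (\<lambda>x y. (x \<bullet> B y) / norm (conormal u))"
    unfolding bilinear_def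
    by (intro conjI allI linearI)
      (simp_all add: linear_add[OF linear_axial_map] linear_scale[OF linear_axial_map]
        inner_add_left inner_add_right add_divide_distrib)
qed (simp add: second_form_entry[OF assms] DX_axis)

lemma first_form_eq_pullback:
  assumes "u \<in> U"
  shows "x \<bullet> (first_form X u *v y) = DX u x \<bullet> DX u y"
proof (rule pullback_bilinear_form[OF linear_DX[OF assms]])
  show "bilinear (\<lambda>x y. x \<bullet> y)"
    unfolding bilinear_def by (intro conjI allI linearI) (simp_all add: inner_add_left inner_add_right)
qed (simp add: first_form_def DX_axis)

lemma DX_nonzero: "u \<in> U \<Longrightarrow> x \<noteq> 0 \<Longrightarrow> DX u x \<noteq> 0"
  using linear_injective_0[OF linear_DX] inj_DX by blast

lemma second_form_positive:
  assumes "u \<in> U" "x \<noteq> 0"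
  shows "0 < x \<bullet> (second_form (ellipsoid v m c r) X u *v x)"
  unfolding second_form_eq_pullback[OF assms(1)]
  by (intro divide_pos_pos norm_conormal_pos axial_map_positive norm_v m_pos DX_nonzero assms)

lemma first_form_positive:
  assumes "u \<in> U" "x \<noteq> 0"
  shows "0 < x \<bullet> (first_form X u *v x)"
  using DX_nonzero[OF assms] by (simp add: first_form_eq_pullback[OF assms(1)])

text \<open>The second fundamental form is the pullback of \<open>B\<close> divided by the length of the conormal, and
  \<open>B\<close> is a perturbation of the identity of rank one. Hence the quotient of the determinants of the two
  fundamental forms depends only on the length of the tangential part of \<open>v\<close>, that is, on the component
  of \<open>v\<close> along the normal.\<close>

lemma gauss_curvature_eq:
  assumes u: "u \<in> U"
  shows "gauss_curvature (ellipsoid v m c r) X u = m * r\<^sup>2 / norm (conormal u) ^ (CARD('n) + 2)"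
proof -
  let ?w = "norm (conormal u)" and ?\<nu> = "unit_normal u"
  define G where "G = first_form X u"
  define b :: "real^'n" where "b = (\<chi> i. pderiv_at i X u \<bullet> v)"
  have G: "invertible G"
    unfolding G_def by (intro invertible_of_positive_definite first_form_positive u)
  define z where "z = matrix_inv G *v b"
  have Gz: "G *v z = b"
    using matrix_inv_mult(1)[OF G] by (simp add: z_def matrix_vector_mul_assoc)
  \<comment> \<open>\<open>DX u z\<close> is the orthogonal projection of \<open>v\<close> to the tangent space.\<close>
  have "pderiv_at i X u \<bullet> DX u z = pderiv_at i X u \<bullet> v" for i
    using first_form_eq_pullback[OF u, of "axis i 1" z]
    by (simp add: DX_axis inner_axis' Gz b_def flip: G_def)
  then have "v - DX u z = ((v - DX u z) \<bullet> ?\<nu>) *\<^sub>R ?\<nu>"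
    by (intro orthogonal_to_tangent_space[OF u]) (simp add: inner_diff_right)
  then have proj: "DX u z = v - (v \<bullet> ?\<nu>) *\<^sub>R ?\<nu>"
    by (simp add: inner_diff_left DX_orthogonal_unit_normal[OF u] algebra_simps)
  have "z \<bullet> b = DX u z \<bullet> v"
    by (simp add: DX_eq_sum[OF u] inner_sum_left b_def inner_vec_def)
  also have "\<dots> = 1 - (v \<bullet> ?\<nu>)\<^sup>2"
    using norm_v by (simp add: proj inner_diff_left inner_diff_right norm_eq_1 power2_eq_square
        inner_commute)
  finally have zb: "z \<bullet> b = 1 - (v \<bullet> ?\<nu>)\<^sup>2" .
  have "second_form (ellipsoid v m c r) X u
      = (1 / ?w) *\<^sub>R (G ** (mat 1 + (\<chi> i j. ((m - 1) *\<^sub>R z) $ i * b $ j)))"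
  proof -
    have "(G ** (\<chi> i j. ((m - 1) *\<^sub>R z) $ i * b $ j)) $ i $ j = (m - 1) * (b $ i * b $ j)" for i j
    proof -
      have "(G ** (\<chi> i j. ((m - 1) *\<^sub>R z) $ i * b $ j)) $ i $ j
          = (m - 1) * ((G *v z) $ i * b $ j)"
        by (simp add: matrix_matrix_mult_def matrix_vector_mult_def sum_distrib_left
            sum_distrib_right mult_ac)
      then show ?thesis
        by (simp add: Gz)
    qed
    then show ?thesis
      by (simp add: vec_eq_iff matrix_add_ldistrib second_form_entry[OF u])
        (simp add: G_def first_form_def b_def axial_map_def inner_add_right inner_commute)
  qed
  then have "det (second_form (ellipsoid v m c r) X u)
      = (1 / ?w) ^ CARD('n) * (det G * (1 + (m - 1) * (1 - (v \<bullet> ?\<nu>)\<^sup>2)))"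
    by (simp only: det_scaleR_matrix det_mul det_rank_one_update inner_scaleR_left zb)
  moreover have "det G \<noteq> 0"
    using G by (simp add: invertible_det_nz)
  ultimately have "gauss_curvature (ellipsoid v m c r) X u
      = (1 + (m - 1) * (1 - (v \<bullet> ?\<nu>)\<^sup>2)) / ?w ^ CARD('n)"
    by (simp add: gauss_curvature_def power_one_over flip: G_def)
  also have "1 + (m - 1) * (1 - (v \<bullet> ?\<nu>)\<^sup>2) = m * r\<^sup>2 / ?w\<^sup>2"
  proof -
    let ?y = "X u - c"
    have vv: "v \<bullet> v = 1"
      using norm_v by (simp add: norm_eq_1)
    have w: "?w\<^sup>2 = ?y \<bullet> ?y + (m\<^sup>2 - 1) * (?y \<bullet> v)\<^sup>2"
      by (simp add: power2_norm_eq_inner conormal_def axial_map_def inner_add_left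
          inner_add_right vv inner_commute) (simp add: power2_eq_square algebra_simps)
    have r: "r\<^sup>2 = ?y \<bullet> ?y + (m - 1) * (?y \<bullet> v)\<^sup>2"
      using X_in_frontier[OF u]
      by (simp add: conormal_def axial_map_def inner_add_right power2_eq_square)
    have "v \<bullet> conormal u = m * (?y \<bullet> v)"
      by (simp add: conormal_def axial_map_def inner_add_right vv inner_commute)
        (simp add: algebra_simps)
    then have "(v \<bullet> ?\<nu>)\<^sup>2 = m\<^sup>2 * (?y \<bullet> v)\<^sup>2 / ?w\<^sup>2"
      by (simp add: unit_normal_def power_divide power_mult_distrib)
    then have "1 + (m - 1) * (1 - (v \<bullet> ?\<nu>)\<^sup>2)
        = (m * ?w\<^sup>2 - (m - 1) * (m\<^sup>2 * (?y \<bullet> v)\<^sup>2)) / ?w\<^sup>2"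
      using norm_conormal_pos[OF u] by (simp add: field_simps)
    also have "m * ?w\<^sup>2 - (m - 1) * (m\<^sup>2 * (?y \<bullet> v)\<^sup>2) = m * r\<^sup>2"
      unfolding w r by (simp add: power2_eq_square algebra_simps)
    finally show ?thesis .
  qed
  finally show ?thesis
    by (simp add: power_add power2_eq_square)
qed

lemma affine_phi_eq:
  assumes u: "u \<in> U"
  shows "affine_phi (ellipsoid v m c r) X u
    = (m * r\<^sup>2) powr (1 / (real CARD('n) + 2)) / norm (conormal u)"
proof -
  let ?w = "norm (conormal u)"
  have "(?w ^ (CARD('n) + 2)) powr (1 / (real CARD('n) + 2))
      = (?w powr real (CARD('n) + 2)) powr (1 / (real CARD('n) + 2))"
    using norm_conormal_pos[OF u] by (simp only: powr_realpow)
  also have "\<dots> = ?w"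
  proof -
    have "real (CARD('n) + 2) * (1 / (real CARD('n) + 2)) = 1"
      by (simp add: field_simps)
    then show ?thesis
      using norm_conormal_pos[OF u] by (simp only: powr_powr powr_one)
  qed
  finally show ?thesis
    using m_pos r_pos norm_conormal_pos[OF u]
    by (simp add: affine_phi_def gauss_curvature_eq[OF u] powr_divide)
qed

lemma pderiv_affine_phi:
  assumes u: "u \<in> U"
  shows "pderiv_at i (affine_phi (ellipsoid v m c r) X) u
    = - ((m * r\<^sup>2) powr (1 / (real CARD('n) + 2)))
        * (B (pderiv_at i X u) \<bullet> conormal u) / norm (conormal u) ^ 3"
proof -
  let ?w = "norm (conormal u)" and ?C = "(m * r\<^sup>2) powr (1 / (real CARD('n) + 2))"
  have nz: "conormal u \<noteq> 0"
    using norm_conormal_pos[OF u] by simp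
  have "((\<lambda>u. norm (conormal u)) has_derivative (\<lambda>h. B (DX u h) \<bullet> sgn (conormal u))) (at u)"
    using has_derivative_compose[OF conormal_has_derivative[OF u] has_derivative_norm[OF nz]] .
  from has_derivative_divide[OF has_derivative_const[of ?C] this]
  have "((\<lambda>u. ?C / norm (conormal u)) has_derivative
      (\<lambda>h. - (?C * (B (DX u h) \<bullet> conormal u) / ?w ^ 3))) (at u)"
    using nz by (simp add: sgn_div_norm field_simps power3_eq_cube)
  then have "(affine_phi (ellipsoid v m c r) X has_derivative
      (\<lambda>h. - (?C * (B (DX u h) \<bullet> conormal u) / ?w ^ 3))) (at u)"
    by (rule has_derivative_transform_within_open) (use open_U u affine_phi_eq in auto)
  from fun_cong[OF frechet_derivative_at[OF this], of "axis i 1"] show ?thesis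
    by (simp add: pderiv_at_def)
qed

text \<open>The affine normal of an ellipsoid points to its center. Put \<open>C = (m * r\<^sup>2) powr (1 / (n + 2))\<close> and
  let \<open>w\<close> be the length of the conormal, so that \<open>\<phi> = C / w\<close>. The tangential part of the affine normal
  is the negative of the vector that represents the differential of \<open>\<phi>\<close> with respect to the
  second fundamental form. The vector \<open>\<tau>\<close> below is tangent and
  represents this differential, so it is that vector, and the multiples of the conormal in
  \<open>- \<tau> + \<phi> \<nu>\<close> cancel.\<close>

lemma affine_normal_eq:
  assumes u: "u \<in> U"
  shows "affine_normal (ellipsoid v m c r) X u
    = - (((m * r\<^sup>2) powr (1 / (real CARD('n) + 2)) / r\<^sup>2) *\<^sub>R (X u - c))"
proof -
  let ?E = "ellipsoid v m c r"
  define C where "C = (m * r\<^sup>2) powr (1 / (real CARD('n) + 2))"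
  define w where "w = norm (conormal u)"
  have w: "0 < w"
    unfolding w_def by (rule norm_conormal_pos[OF u])
  have conormal_sq: "conormal u \<bullet> conormal u = w\<^sup>2"
    by (simp add: w_def power2_norm_eq_inner)
  define H where "H = second_form ?E X u"
  have H: "invertible H"
    unfolding H_def by (intro invertible_of_positive_definite second_form_positive u)
  define d\<phi> where "d\<phi> = (\<chi> i. pderiv_at i (affine_phi ?E X) u)"
  define \<tau> where "\<tau> = (C / r\<^sup>2) *\<^sub>R (X u - c) - (C / w\<^sup>2) *\<^sub>R conormal u"
  have "\<tau> \<bullet> conormal u = 0"
    unfolding \<tau>_def inner_diff_left[of "(C / r\<^sup>2) *\<^sub>R (X u - c)"] inner_scaleR_left
      X_in_frontier[OF u] conormal_sq
    using w r_pos by simp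
  then have "\<tau> \<bullet> unit_normal u = 0"
    by (simp add: unit_normal_def)
  then obtain b where b: "\<tau> = DX u b"
    using tangential_plus_normal[OF u, of \<tau>] by auto
  have "H *v b = d\<phi>"
  proof -
    have "(H *v b) $ i = d\<phi> $ i" for i
    proof -
      have "(H *v b) $ i = axis i 1 \<bullet> (H *v b)"
        by (simp add: inner_axis')
      also have "\<dots> = (B (pderiv_at i X u) \<bullet> \<tau>) / w"
        unfolding H_def second_form_eq_pullback[OF u] DX_axis b w_def inner_axial_map ..
      also have "B (pderiv_at i X u) \<bullet> (X u - c) = 0"
        using pderiv_orthogonal_conormal[OF u] by (simp add: inner_axial_map conormal_def)
      then have "B (pderiv_at i X u) \<bullet> \<tau> = - ((C / w\<^sup>2) * (B (pderiv_at i X u) \<bullet> conormal u))"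
        by (simp add: \<tau>_def inner_diff_right)
      finally have "(H *v b) $ i = - (C * (B (pderiv_at i X u) \<bullet> conormal u)) / w ^ 3"
        using w by (simp add: power2_eq_square power3_eq_cube)
      then show ?thesis
        by (simp add: d\<phi>_def pderiv_affine_phi[OF u] C_def w_def)
    qed
    then show ?thesis
      by (simp add: vec_eq_iff)
  qed
  then have "matrix_inv H *v d\<phi> = b"
    using matrix_inv_mult(2)[OF H] by (metis matrix_vector_mul_assoc matrix_vector_mul_lid)
  then have "(\<Sum>i\<in>UNIV. matrix_inv H $ k $ i * d\<phi> $ i) = b $ k" for k
    by (auto simp: matrix_vector_mult_def)
  then have "(\<Sum>k\<in>UNIV. \<Sum>i\<in>UNIV. (matrix_inv H $ k $ i * d\<phi> $ i) *\<^sub>R pderiv_at k X u) = \<tau>"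
    by (simp add: b DX_eq_sum[OF u] flip: scaleR_sum_left)
  then have "affine_normal ?E X u = - \<tau> + (C / w) *\<^sub>R unit_normal u"
    by (simp add: affine_normal_def inward_normal_eq[OF u] affine_phi_eq[OF u] H_def d\<phi>_def
        flip: C_def w_def)
  then have "affine_normal ?E X u = - ((C / r\<^sup>2) *\<^sub>R (X u - c))"
    by (simp add: \<tau>_def unit_normal_def power2_eq_square flip: w_def)
  then show ?thesis
    by (simp only: C_def)
qed

end

section \<open>Shrinking ellipsoids\<close>

lemma smooth_bounded_domain_ellipsoid:
  fixes v :: "'n::finite ambient"
  assumes "norm v = 1" "0 < m" "0 < r"
  shows "smooth_bounded_domain (ellipsoid v m c r)"
proof -
  have "strictly_convex_boundary (ellipsoid v m c r)"
    unfolding strictly_convex_boundary_def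
  proof (intro allI impI ballI)
    fix U X u and x :: "real^'n"
    assume X: "local_parametrization (frontier (ellipsoid v m c r)) U X" and u: "u \<in> U" "x \<noteq> 0"
    interpret ellipsoid_chart v c m r U X
      by unfold_locales (use assms X in auto)
    show "0 < x \<bullet> (second_form (ellipsoid v m c r) X u *v x)"
      by (rule second_form_positive[OF u])
  qed
  then show ?thesis
    using center_in_ellipsoid[OF assms, of c] open_ellipsoid[OF assms] convex_ellipsoid[OF assms]
      bounded_ellipsoid[OF assms] smooth_hypersurface_frontier_ellipsoid[OF assms]
    by (auto simp: smooth_bounded_domain_def convex_domain_def)
qed

text \<open>By \<open>speed_eq_powr\<close> the homothetic solution with parameter \<open>r(t)\<close> satisfies
  \<open>r' = - m powr (1 / (n + 2)) * r powr (1 - flow_exponent n)\<close>, so \<open>r powr flow_exponent n\<close> decreases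
  linearly; the next two definitions express its zero and \<open>r(t) / r(0)\<close>.\<close>

definition flow_exponent :: "real \<Rightarrow> real" where
  "flow_exponent n = (2 * n + 2) / (n + 2)"

definition extinction_time :: "real \<Rightarrow> real \<Rightarrow> real \<Rightarrow> real" where
  "extinction_time n m r = r powr flow_exponent n / (flow_exponent n * m powr (1 / (n + 2)))"

definition shrink_factor :: "real \<Rightarrow> real \<Rightarrow> real \<Rightarrow> real \<Rightarrow> real" where
  "shrink_factor n m r t = (1 - t / extinction_time n m r) powr (1 / flow_exponent n)"

lemma flow_exponent_pos: "0 < n \<Longrightarrow> 0 < flow_exponent n"
  by (simp add: flow_exponent_def)

lemma extinction_time_pos: "0 < n \<Longrightarrow> 0 < m \<Longrightarrow> 0 < r \<Longrightarrow> 0 < extinction_time n m r"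
  by (simp add: extinction_time_def flow_exponent_pos)

lemma speed_eq_powr:
  assumes "0 < n" "0 < m" "0 < r"
  shows "(m * r\<^sup>2) powr (1 / (n + 2)) / r\<^sup>2 = m powr (1 / (n + 2)) * r powr (- flow_exponent n)"
proof -
  have "(r\<^sup>2) powr (1 / (n + 2)) / r\<^sup>2 = (r powr 2) powr (1 / (n + 2)) / r powr 2"
    using assms by simp
  also have "\<dots> = r powr (2 * (1 / (n + 2)) - 2)"
    by (simp only: powr_powr powr_diff)
  also have "2 * (1 / (n + 2)) - 2 = - flow_exponent n"
    using assms by (simp add: flow_exponent_def field_simps)
  finally have "(r\<^sup>2) powr (1 / (n + 2)) / r\<^sup>2 = r powr (- flow_exponent n)" .
  moreover have "(m * r\<^sup>2) powr (1 / (n + 2)) / r\<^sup>2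
      = m powr (1 / (n + 2)) * ((r\<^sup>2) powr (1 / (n + 2)) / r\<^sup>2)"
    using assms by (simp add: powr_mult)
  ultimately show ?thesis
    by simp
qed

lemma shrink_factor_has_derivative:
  assumes "0 < n" "0 < m" "0 < r" and t: "t < extinction_time n m r"
  defines "\<rho> \<equiv> shrink_factor n m r"
  shows "(\<rho> has_real_derivative
    - ((m * (\<rho> t * r)\<^sup>2) powr (1 / (n + 2)) / (\<rho> t * r)\<^sup>2 * \<rho> t)) (at t within S)"
proof -
  define T where "T = extinction_time n m r"
  define \<kappa> where "\<kappa> = flow_exponent n"
  define \<beta> where "\<beta> = m powr (1 / (n + 2))"
  define a where "a = 1 - t / T"
  have T: "0 < T" and \<kappa>: "0 < \<kappa>" and \<beta>: "0 < \<beta>"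
    using assms by (auto simp: T_def \<kappa>_def \<beta>_def extinction_time_pos flow_exponent_pos)
  have a: "0 < a"
    using t T by (simp add: a_def flip: T_def)
  have \<rho>_t: "\<rho> t = a powr (1 / \<kappa>)"
    by (simp add: \<rho>_def shrink_factor_def a_def T_def \<kappa>_def)
  then have \<rho>_pos: "0 < \<rho> t"
    using a by simp
  have "(\<rho> has_real_derivative 1 / \<kappa> * a powr (1 / \<kappa> - 1) * (- 1 / T)) (at t within S)"
    unfolding \<rho>_def shrink_factor_def[abs_def] T_def[symmetric] \<kappa>_def[symmetric] a_def
    by (rule derivative_eq_intros refl | use a T in \<open>simp add: a_def\<close>)+
  moreover have "1 / \<kappa> * a powr (1 / \<kappa> - 1) * (- 1 / T) = - (\<beta> * r powr (- \<kappa>) * (\<rho> t / a))"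
    using a \<kappa> \<beta> assms(3)
    by (simp add: T_def extinction_time_def powr_diff powr_minus_divide \<rho>_t mult_ac
        flip: \<kappa>_def \<beta>_def)
  moreover have "(m * (\<rho> t * r)\<^sup>2) powr (1 / (n + 2)) / (\<rho> t * r)\<^sup>2 * \<rho> t
      = \<beta> * r powr (- \<kappa>) * (\<rho> t / a)"
  proof -
    have "\<rho> t powr (- \<kappa>) = 1 / a"
      using a \<kappa> by (simp add: \<rho>_t powr_powr powr_minus_divide)
    then show ?thesis
      unfolding speed_eq_powr[OF assms(1,2) mult_pos_pos[OF \<rho>_pos assms(3)]]
      using assms(3) \<rho>_pos by (simp add: powr_mult \<beta>_def \<kappa>_def)
  qed
  ultimately show ?thesis
    by simp
qed

text \<open>Both the velocity of the homothety about \<open>c\<close> and the affine normal are multiples of the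
  position relative to \<open>c\<close>, and the factors agree by the differential equation for the shrinking
  factor.\<close>

lemma affine_normal_flow_ellipsoid:
  fixes v c :: "'n::finite ambient"
  assumes v: "norm v = 1" and m: "0 < m" and r: "0 < r"
  defines "\<rho> \<equiv> shrink_factor (real CARD('n)) m r" and "T \<equiv> extinction_time (real CARD('n)) m r"
  shows "affine_normal_flow (ellipsoid v m c r) T (\<lambda>p t. c + \<rho> t *\<^sub>R (p - c))
    (\<lambda>t. ellipsoid v m c (\<rho> t * r))"
proof -
  let ?M = "frontier (ellipsoid v m c r)"
  define \<kappa> where "\<kappa> = flow_exponent (real CARD('n))"
  have n: "0 < real CARD('n)"
    by simp
  have T: "0 < T" and \<kappa>: "0 < \<kappa>"
    using m r by (simp_all add: T_def \<kappa>_def extinction_time_pos flow_exponent_pos)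
  have \<rho>_eq: "\<rho> t = (1 + (- 1 / T) * t) powr (1 / \<kappa>)" for t
    by (simp add: \<rho>_def shrink_factor_def T_def \<kappa>_def)
  have pos: "0 < 1 + (- 1 / T) * t" if "t < T" for t
    using that T by (simp add: field_simps)
  have \<rho>: "0 < \<rho> t" if "t < T" for t
    unfolding \<rho>_eq powr_gt_zero using pos[OF that] by linarith
  have image: "frontier (ellipsoid v m c (\<rho> t * r)) = (\<lambda>p. c + \<rho> t *\<^sub>R (p - c)) ` ?M" if t: "t < T" for t
  proof -
    let ?f = "\<lambda>p. c + \<rho> t *\<^sub>R (p - c)"
    have form: "(?f p - c) \<bullet> axial_map v m (?f p - c) = (\<rho> t)\<^sup>2 * ((p - c) \<bullet> axial_map v m (p - c))"
      for p
      by (simp add: linear_scale[OF linear_axial_map] power2_eq_square)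
    have mem: "?f p \<in> frontier (ellipsoid v m c (\<rho> t * r)) \<longleftrightarrow> p \<in> ?M" for p
      using \<rho>[OF t] r unfolding frontier_ellipsoid[OF v m r]
        frontier_ellipsoid[OF v m mult_pos_pos[OF \<rho>[OF t] r]] mem_Collect_eq form
      by (simp add: power_mult_distrib)
    have inv: "?f (c + (1 / \<rho> t) *\<^sub>R (q - c)) = q" for q
      using \<rho>[OF t] by simp
    show ?thesis
    proof (intro equalityI subsetI)
      fix q assume "q \<in> frontier (ellipsoid v m c (\<rho> t * r))"
      then have "c + (1 / \<rho> t) *\<^sub>R (q - c) \<in> ?M"
        unfolding mem[symmetric] inv .
      then show "q \<in> ?f ` ?M"
        by (rule image_eqI[of q ?f, OF inv[symmetric]])
    next
      fix q assume "q \<in> ?f ` ?M"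
      then show "q \<in> frontier (ellipsoid v m c (\<rho> t * r))"
        using mem by auto
    qed
  qed
  have smooth: "smooth_map_on (?M \<times> {0..<T}) (\<lambda>(p, t). c + \<rho> t *\<^sub>R (p - c))"
  proof -
    let ?W = "(UNIV :: 'n ambient set) \<times> {..<T}"
    have W: "open ?W"
      by (simp add: open_Times)
    have "Ck_on k ?W (\<lambda>z. c + ((1 + (- 1 / T) * snd z) powr (1 / \<kappa>)) *\<^sub>R (fst z + (- c)))" for k
    proof (rule Ck_on_add[OF W Ck_on_const Ck_on_bilinear[OF W bounded_bilinear_scaleR
            Ck_on_powr[OF W _ Ck_on_add[OF W Ck_on_const]] Ck_on_add[OF W _ Ck_on_const]]])
      show "Ck_on k ?W (\<lambda>z. (- 1 / T) * snd z)" "Ck_on k ?W fst"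
        by (intro Ck_on_bounded_linear[OF W] bounded_linear_fst
            bounded_linear_compose[OF bounded_linear_mult_right bounded_linear_snd])+
    qed (use pos in auto)
    then have "smooth_on_open ?W (\<lambda>(p, t). c + \<rho> t *\<^sub>R (p - c))"
      by (simp add: smooth_on_open_def \<rho>_eq case_prod_beta')
    then show ?thesis
      unfolding smooth_map_on_def using W by fastforce
  qed
  have limit: "uniform_limit ?M (\<lambda>t p. c + \<rho> t *\<^sub>R (p - c)) (\<lambda>p. c) (at_left T)"
  proof (rule uniform_limitI)
    fix e :: real assume e: "0 < e"
    have "bounded ?M"
      using bounded_closure[OF bounded_ellipsoid[OF v m r]] by (simp add: frontier_def bounded_diff)
    then have "bounded ((\<lambda>p. p - c) ` ?M)"
      by (rule bounded_translation_minus)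
    then obtain b where b: "0 < b" "\<And>p. p \<in> ?M \<Longrightarrow> norm (p - c) \<le> b"
      by (auto simp: bounded_pos)
    have "((\<lambda>t. 1 + (- 1 / T) * t) \<longlongrightarrow> 1 + (- 1 / T) * T) (at_left T)"
      by (intro tendsto_intros)
    then have "((\<lambda>t. 1 + (- 1 / T) * t) \<longlongrightarrow> 0) (at_left T)"
      using T by simp
    moreover have lt: "\<forall>\<^sub>F t in at_left T. t < T"
      by (simp add: eventually_at_filter)
    ultimately have "(\<rho> \<longlongrightarrow> 0) (at_left T)"
      unfolding \<rho>_eq[abs_def] using \<kappa>
      by (intro tendsto_zero_powrI[OF _ tendsto_const])
        (auto elim!: eventually_mono dest!: pos)
    from order_tendstoD(2)[OF this, of "e / b"] e b(1)
    have "\<forall>\<^sub>F t in at_left T. \<rho> t < e / b"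
      by simp
    then show "\<forall>\<^sub>F t in at_left T. \<forall>p\<in>?M. dist (c + \<rho> t *\<^sub>R (p - c)) c < e"
      using lt
    proof eventually_elim
      case (elim t)
      show ?case
      proof
        fix p assume "p \<in> ?M"
        then have "dist (c + \<rho> t *\<^sub>R (p - c)) c \<le> \<rho> t * b"
          using b(2) \<rho>[OF elim(2)] by (simp add: dist_norm mult_left_mono)
        also have "\<dots> < e"
          using elim(1) b(1) by (simp add: field_simps)
        finally show "dist (c + \<rho> t *\<^sub>R (p - c)) c < e" .
      qed
    qed
  qed
  have inj: "inj_on (\<lambda>p. c + \<rho> t *\<^sub>R (p - c)) ?M" if "t < T" for t
    using \<rho>[OF that] by (auto simp: inj_on_def)
  have par: "local_parametrization (frontier (ellipsoid v m c (\<rho> t * r))) U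
      (\<lambda>u. c + \<rho> t *\<^sub>R (X u - c))"
    if t: "t < T" and X: "local_parametrization ?M U X" for t U X
  proof -
    have eq: "c + \<rho> t *\<^sub>R (p - c) = (c - \<rho> t *\<^sub>R c) + \<rho> t *\<^sub>R p" for p
      by (simp add: algebra_simps)
    show ?thesis
      unfolding image[OF t] eq using \<rho>[OF t]
      by (intro local_parametrization_affine_image[OF X] linear_scale_self injI) auto
  qed
  have velocity: "((\<lambda>s. c + \<rho> s *\<^sub>R (X u - c)) has_vector_derivative
      affine_normal (ellipsoid v m c (\<rho> t * r)) (\<lambda>u. c + \<rho> t *\<^sub>R (X u - c)) u)
      (at t within {0..<T})"
    if t: "t < T" and X: "local_parametrization ?M U X" and u: "u \<in> U" for t U X u
  proof -
    let ?d = "- ((m * (\<rho> t * r)\<^sup>2) powr (1 / (real CARD('n) + 2)) / (\<rho> t * r)\<^sup>2 * \<rho> t)"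
    interpret ellipsoid_chart v c m "\<rho> t * r" U "\<lambda>u. c + \<rho> t *\<^sub>R (X u - c)"
      by unfold_locales (use v m r \<rho>[OF t] par[OF t X] in auto)
    have "(\<rho> has_real_derivative ?d) (at t within {0..<T})"
      unfolding \<rho>_def by (rule shrink_factor_has_derivative[OF n m r]) (use t in \<open>simp add: T_def\<close>)
    then have "((\<lambda>s. \<rho> s *\<^sub>R (X u - c)) has_vector_derivative ?d *\<^sub>R (X u - c)) (at t within {0..<T})"
      using has_vector_derivative_scaleR[OF _ has_vector_derivative_const] by force
    then have "((\<lambda>s. c + \<rho> s *\<^sub>R (X u - c)) has_vector_derivative ?d *\<^sub>R (X u - c)) (at t within {0..<T})"
      using has_vector_derivative_add[OF has_vector_derivative_const] by force
    moreover have "affine_normal (ellipsoid v m c (\<rho> t * r)) (\<lambda>u. c + \<rho> t *\<^sub>R (X u - c)) u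
        = ?d *\<^sub>R (X u - c)"
      unfolding affine_normal_eq[OF u] by simp
    ultimately show ?thesis
      by simp
  qed
  have "smooth_bounded_domain (ellipsoid v m c (\<rho> t * r))" if "t < T" for t
    using smooth_bounded_domain_ellipsoid[OF v m] r \<rho>[OF that] by simp
  moreover have "\<rho> 0 = 1"
    by (simp add: \<rho>_eq)
  ultimately show ?thesis
    unfolding affine_normal_flow_def
    using T smooth image inj par velocity limit
    by (auto simp del: split_paired_Ex split_paired_All)
qed

section \<open>Elongated ellipsoids in unbounded convex sets\<close>

text \<open>The convex hull of a ball in \<open>K\<close> and a far point of \<open>K\<close> contains a tube around half of the
  segment from the center of the ball to that point.\<close>

lemma convex_tube_subset:
  fixes K :: "'a::real_normed_vector set"
  assumes "convex K" "ball p (2 * r) \<subseteq> K" "p + R *\<^sub>R v \<in> K" "0 < R"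
    and s: "0 \<le> s" "s \<le> R / 2" and z: "norm z < r"
  shows "p + s *\<^sub>R v + z \<in> K"
proof -
  define l where "l = s / R"
  have l: "0 \<le> l" "l \<le> 1 / 2" "l * R = s"
    using s assms(4) by (auto simp: l_def field_simps)
  have "norm ((1 / (1 - l)) *\<^sub>R z) = norm z / (1 - l)"
    using l by simp
  also have "\<dots> \<le> norm z / (1 / 2)"
    using l by (intro divide_left_mono) auto
  also have "\<dots> < 2 * r"
    using z by simp
  finally have "p + (1 / (1 - l)) *\<^sub>R z \<in> K"
    using assms(2) by (auto simp: dist_norm)
  then have "(1 - l) *\<^sub>R (p + (1 / (1 - l)) *\<^sub>R z) + l *\<^sub>R (p + R *\<^sub>R v) \<in> K"
    using assms(1,3) l by (intro convexD) auto
  moreover have "(1 - l) *\<^sub>R (p + (1 / (1 - l)) *\<^sub>R z) + l *\<^sub>R (p + R *\<^sub>R v) = p + s *\<^sub>R v + z"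
    using l by (simp add: algebra_simps flip: l(3))
  ultimately show ?thesis
    by simp
qed

text \<open>The radius \<open>r\<close> is chosen before \<open>\<mu>\<close>: the ellipsoids get longer but not thinner, which is what
  makes their extinction times unbounded.\<close>

lemma unbounded_convex_contains_elongated_ellipsoids:
  fixes K :: "'a::euclidean_space set"
  assumes "open K" "convex K" "K \<noteq> {}" "\<not> bounded K"
  obtains r where "0 < r"
    "\<And>\<mu>. 0 < \<mu> \<Longrightarrow> \<exists>v m c. norm v = 1 \<and> 0 < m \<and> m < \<mu> \<and> ellipsoid v m c r \<subseteq> K"
proof -
  obtain p e where e: "0 < e" "ball p e \<subseteq> K"
    using assms(1,3) openE by blast
  define r where "r = e / 2"
  have r: "0 < r" "ball p (2 * r) \<subseteq> K"
    using e by (auto simp: r_def)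
  have "\<exists>v m c. norm v = 1 \<and> 0 < m \<and> m < \<mu> \<and> ellipsoid v m c r \<subseteq> K" if \<mu>: "0 < \<mu>" for \<mu>
  proof -
    define b where "b = max (4 * r) (4 * r / sqrt \<mu>)"
    have "0 < b"
      using r by (simp add: b_def)
    have "\<exists>x\<in>K. b < norm (x - p)"
    proof (rule ccontr)
      assume "\<not> ?thesis"
      then have "K \<subseteq> cball p b"
        by (force simp: dist_norm norm_minus_commute)
      then show False
        using assms(4) bounded_cball bounded_subset by blast
    qed
    then obtain x where x: "x \<in> K" "b < norm (x - p)"
      by blast
    define R where "R = norm (x - p)"
    define v where "v = (1 / R) *\<^sub>R (x - p)"
    have R: "0 < R" "4 * r < R" "4 * r / sqrt \<mu> < R"
      using x(2) \<open>0 < b\<close> by (auto simp: R_def b_def)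
    have v: "norm v = 1" "p + R *\<^sub>R v = x"
      using R(1) by (auto simp: v_def R_def)
    \<comment> \<open>The semiaxis in direction \<open>v\<close>, which is \<open>r / sqrt m\<close>, shall be \<open>R / 4\<close>.\<close>
    define m where "m = (4 * r / R)\<^sup>2"
    have sqrt_m: "sqrt m = 4 * r / R"
      using r R(1) by (simp add: m_def)
    have m: "0 < m"
      using r R(1) by (simp add: m_def)
    have "sqrt m < sqrt \<mu>"
      using R \<mu> unfolding sqrt_m by (simp add: field_simps)
    then have "m < \<mu>"
      by simp
    moreover have "ellipsoid v m (p + (R / 4) *\<^sub>R v) r \<subseteq> K"
    proof
      fix q assume "q \<in> ellipsoid v m (p + (R / 4) *\<^sub>R v) r"
      then obtain y where y: "norm y < 1"
        and q: "q = p + (R / 4) *\<^sub>R v + ellipsoid_semiaxes v m r y"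
        unfolding ellipsoid_eq_image_ball[OF v(1) m r(1)] by auto
      define a where "a = (R / 4 - r) * (y \<bullet> v)"
      have "ellipsoid_semiaxes v m r y = r *\<^sub>R y + a *\<^sub>R v"
        using r R(1)
        by (simp add: ellipsoid_semiaxes_def axial_map_def sqrt_m a_def scaleR_add_right)
          (simp add: field_simps)
      then have "q = p + (R / 4 + a) *\<^sub>R v + r *\<^sub>R y"
        by (simp add: q algebra_simps)
      moreover have "\<bar>y \<bullet> v\<bar> \<le> 1"
        using Cauchy_Schwarz_ineq2[of y v] y v(1) by simp
      then have "\<bar>a\<bar> \<le> (R / 4 - r) * 1"
        unfolding a_def abs_mult using R by (intro mult_mono) auto
      then have "0 \<le> R / 4 + a" "R / 4 + a \<le> R / 2"
        using r by auto
      ultimately show "q \<in> K"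
        using convex_tube_subset[OF assms(2) r(2), of R v "R / 4 + a" "r *\<^sub>R y"] x(1) v(2) y r R(1)
        by (simp add: mult.commute)
    qed
    ultimately show ?thesis
      using v(1) m by blast
  qed
  then show thesis
    using r(1) that by blast
qed

lemma less_extinction_time:
  assumes "0 < n" "0 < r" "0 < t" "0 < m"
    and "m < (r powr flow_exponent n / (flow_exponent n * t)) powr (n + 2)"
  shows "t < extinction_time n m r"
proof -
  let ?\<eta> = "r powr flow_exponent n / (flow_exponent n * t)"
  have \<kappa>: "0 < flow_exponent n"
    using assms(1) by (rule flow_exponent_pos)
  then have "0 < ?\<eta>"
    using assms by simp
  have "m powr (1 / (n + 2)) < (?\<eta> powr (n + 2)) powr (1 / (n + 2))"
    using assms by (intro powr_less_mono2) auto
  also have "\<dots> = ?\<eta>"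
  proof -
    have "(n + 2) * (1 / (n + 2)) = 1"
      using assms(1) by simp
    then show ?thesis
      using \<open>0 < ?\<eta>\<close> by (simp only: powr_powr powr_one)
  qed
  finally show ?thesis
    using assms \<kappa> by (simp add: extinction_time_def field_simps)
qed

theorem theorem8p2:
  fixes K :: "'n::finite ambient set"
  assumes "convex_domain K"
    and "\<not> bounded K"
    and "contains_no_lines K"
  shows "\<forall>t>0. evolved_convex_set K t \<noteq> {}"
proof (intro allI impI)
  fix t :: real assume t: "0 < t"
  let ?n = "real CARD('n)"
  have "open K" "convex K" "K \<noteq> {}"
    using assms(1) by (auto simp: convex_domain_def)
  then obtain r where r: "0 < r"
    and ell: "\<And>\<mu>. 0 < \<mu> \<Longrightarrow>
      \<exists>v m c. norm v = 1 \<and> 0 < m \<and> m < \<mu> \<and> ellipsoid v m c r \<subseteq> K"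
    using unbounded_convex_contains_elongated_ellipsoids[OF _ _ _ assms(2)] by metis
  have "0 < (r powr flow_exponent ?n / (flow_exponent ?n * t)) powr (?n + 2)"
    using r t flow_exponent_pos[of ?n] by simp
  from ell[OF this] obtain v m c where v: "norm v = 1" and m: "0 < m"
    and small: "m < (r powr flow_exponent ?n / (flow_exponent ?n * t)) powr (?n + 2)"
    and subset: "ellipsoid v m c r \<subseteq> K"
    by blast
  let ?D = "\<lambda>t. ellipsoid v m c (shrink_factor ?n m r t * r)"
  have lt: "t < extinction_time ?n m r"
    by (rule less_extinction_time[OF _ r t m small]) simp
  then have "?D t \<subseteq> evolved_smooth_domain (ellipsoid v m c r) t"
    unfolding evolved_smooth_domain_def
    using affine_normal_flow_ellipsoid[OF v m r, of c] t by fastforce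
  moreover have "0 < shrink_factor ?n m r t"
    using lt t extinction_time_pos[of ?n m r] m r by (simp add: shrink_factor_def)
  then have "c \<in> ?D t"
    by (intro center_in_ellipsoid v m mult_pos_pos r)
  ultimately show "evolved_convex_set K t \<noteq> {}"
    unfolding evolved_convex_set_def
    using subset smooth_bounded_domain_ellipsoid[OF v m r, of c] by blast
qed

end
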